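(* Consider scale-free percolation on $\mathbb{Z}^d$ ($d\ge1$) with parameters $\tau>1$, $\alpha>0$, $\lambda>\lambda_c$ such that $\gamma:=\alpha(\tau-1)/d>2$ and $d<\alpha<2d$, and assume that either $\tau\ge3$, or $\tau<3$ and $\alpha(\tau-2)\ge d$. Assume in addition that all nearest-neighbour edges are open (i.e. all edges $\{x,y\}$ with $|x-y|=1$ are added to the set of open edges). Let $D(x,y)$ be the graph distance in the resulting random graph and $\Delta=\frac{\log 2}{\log(2d/\alpha)}$. Then there exists a constant $C>0$ such that $$\lim_{|x-y|\to\infty}\mathbb{P}\Big(D(x,y)\le C\big(\log|x-y|\big)^{\Delta}\Big)=1 .$$
   Context: Scale-free percolation: let $d\ge1$, $\tau>1$, $\alpha,\lambda>0$. Assign to the vertices $x\in\mathbb{Z}^d$ i.i.d. weights $W_x$ with $\mathbb{P}(W_x\ge w)=w^{-(\tau-1)}$ for $w\ge1$. Conditionally on all the weights, each edge $\{x,y\}$ with $x\ne y\in\mathbb{Z}^d$ is declared open, independently of all other edges, with probability $$p_{x,y}=1-\exp\Big(-\lambda\frac{W_xW_y}{|x-y|^\alpha}\Big),$$ where $|\cdot|$ is the Euclidean norm. The graph distance $D(x,y)$ is the length (number of edges) of a shortest open path between $x$ and $y$. $\lambda_c$ is the critical percolation value of the model (without the added nearest-neighbour edges), i.e. the infimum of those $\lambda>0$ for which an infinite open cluster exists with positive probability. *)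

theory Defs
  imports "HOL-Probability.Probability"
begin

section \<open>Graphs given by a set of edges\<close>

definition open_path :: "'v set set \<Rightarrow> 'v list \<Rightarrow> 'v \<Rightarrow> 'v \<Rightarrow> bool" where
  "open_path E xs x y \<longleftrightarrow>
     xs \<noteq> [] \<and> hd xs = x \<and> last xs = y \<and> distinct xs \<and> successively (\<lambda>u v. {u, v} \<in> E) xs"

text \<open>The value is \<open>\<infinity>\<close> if \<open>x\<close> and \<open>y\<close> are not connected.\<close>

definition graph_dist :: "'v set set \<Rightarrow> 'v \<Rightarrow> 'v \<Rightarrow> enat" where
  "graph_dist E x y = (INF xs\<in>{xs. open_path E xs x y}. enat (length xs - 1))"

definition cluster :: "'v set set \<Rightarrow> 'v \<Rightarrow> 'v set" where
  "cluster E x = {y. \<exists>xs. open_path E xs x y}"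

section \<open>Scale-free percolation\<close>

definition real_point :: "int ^ 'd \<Rightarrow> real ^ 'd" where
  "real_point x = (\<chi> i. real_of_int (x $ i))"

definition lattice_dist :: "int ^ 'd \<Rightarrow> int ^ 'd \<Rightarrow> real" where
  "lattice_dist x y = norm (real_point x - real_point y)"

definition lattice_edges :: "(int ^ 'd) set set" where
  "lattice_edges = {{x, y} | x y. x \<noteq> y}"

definition nn_edges :: "(int ^ 'd) set set" where
  "nn_edges = {{x, y} | x y. lattice_dist x y = 1}"

definition weight_law :: "real \<Rightarrow> real measure" where
  "weight_law \<tau> = interval_measure (\<lambda>w. if w < 1 then 0 else 1 - w powr (- (\<tau> - 1)))"

definition weights_law :: "real \<Rightarrow> (int ^ 'd \<Rightarrow> real) measure" where
  "weights_law \<tau> = (\<Pi>\<^sub>M x\<in>UNIV. weight_law \<tau>)"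

definition connection_prob ::
    "real \<Rightarrow> real \<Rightarrow> (int ^ 'd \<Rightarrow> real) \<Rightarrow> int ^ 'd \<Rightarrow> int ^ 'd \<Rightarrow> real" where
  "connection_prob \<alpha> lam W x y = 1 - exp (- (lam * (W x * W y / lattice_dist x y powr \<alpha>)))"

text \<open>The same probability as a function of the unordered edge (see \<open>edge_prob_doubleton\<close>).\<close>

definition edge_prob ::
    "real \<Rightarrow> real \<Rightarrow> (int ^ 'd \<Rightarrow> real) \<Rightarrow> (int ^ 'd) set \<Rightarrow> real" where
  "edge_prob \<alpha> lam W e =
     (THE p. \<exists>x y. e = {x, y} \<and> x \<noteq> y \<and> p = connection_prob \<alpha> lam W x y)"

definition edge_config_space :: "((int ^ 'd) set \<Rightarrow> bool) measure" where
  "edge_config_space = (\<Pi>\<^sub>M e\<in>lattice_edges. count_space UNIV)"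

text \<open>The conditional law of the edge configuration given the weights.\<close>

definition edges_law ::
    "real \<Rightarrow> real \<Rightarrow> (int ^ 'd \<Rightarrow> real) \<Rightarrow> ((int ^ 'd) set \<Rightarrow> bool) measure" where
  "edges_law \<alpha> lam W =
     (\<Pi>\<^sub>M e\<in>lattice_edges. measure_pmf (bernoulli_pmf (edge_prob \<alpha> lam W e)))"

text \<open>The joint law of the weights and the edge configuration (see \<open>emeasure_sfp\<close>).\<close>

definition sfp ::
    "real \<Rightarrow> real \<Rightarrow> real \<Rightarrow> ((int ^ 'd \<Rightarrow> real) \<times> ((int ^ 'd) set \<Rightarrow> bool)) measure" where
  "sfp \<tau> \<alpha> lam =
     weights_law \<tau> \<bind>
       (\<lambda>W. distr (edges_law \<alpha> lam W) (weights_law \<tau> \<Otimes>\<^sub>M edge_config_space) (Pair W))"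

definition open_edges ::
    "(int ^ 'd \<Rightarrow> real) \<times> ((int ^ 'd) set \<Rightarrow> bool) \<Rightarrow> (int ^ 'd) set set" where
  "open_edges \<omega> = {e \<in> lattice_edges. snd \<omega> e}"

text \<open>
  The infimum is taken in \<open>ereal\<close>, so that it is \<open>\<infinity>\<close> if there is no percolation at all.
  The type argument carries the dimension.
\<close>

definition critical_lambda :: "'d::finite itself \<Rightarrow> real \<Rightarrow> real \<Rightarrow> ereal" where
  "critical_lambda (_ :: 'd itself) \<tau> \<alpha> =
     Inf {ereal lam | lam. lam > 0 \<and>
       measure (sfp \<tau> \<alpha> lam)
         {\<omega> \<in> space (sfp \<tau> \<alpha> lam). \<exists>x :: int ^ 'd. infinite (cluster (open_edges \<omega>) x)} > 0}"

section \<open>The model is well defined\<close>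

lemma lattice_dist_commute: "lattice_dist x y = lattice_dist y x"
  by (simp add: lattice_dist_def norm_minus_commute)

lemma edge_prob_doubleton:
  assumes "x \<noteq> y"
  shows "edge_prob \<alpha> lam W {x, y} = connection_prob \<alpha> lam W x y"
  unfolding edge_prob_def
proof (rule the_equality)
  show "\<exists>u v. {x, y} = {u, v} \<and> u \<noteq> v \<and> connection_prob \<alpha> lam W x y = connection_prob \<alpha> lam W u v"
    using assms by blast
qed (auto simp: doubleton_eq_iff connection_prob_def lattice_dist_commute mult.commute)

context
  fixes \<tau> :: real
  assumes \<tau>: "\<tau> > 1"
begin

private abbreviation "F \<equiv> (\<lambda>w::real. if w < 1 then 0 else 1 - w powr (- (\<tau> - 1)))"

private lemma F_mono: "x \<le> y \<Longrightarrow> F x \<le> F y"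
proof -
  assume "x \<le> y"
  have "w powr (- (\<tau> - 1)) \<le> 1" if "w \<ge> 1" for w :: real
    using powr_mono2'[of "- (\<tau> - 1)" 1 w] that \<tau> by simp
  moreover have "y powr (- (\<tau> - 1)) \<le> x powr (- (\<tau> - 1))" if "x \<ge> 1"
    using powr_mono2'[of "- (\<tau> - 1)" x y] that \<tau> \<open>x \<le> y\<close> by simp
  ultimately show ?thesis using \<open>x \<le> y\<close> by auto
qed

private lemma F_alt: "F w = 1 - (max 1 w) powr (- (\<tau> - 1))"
  by (auto simp: max_def)

private lemma F_cont: "isCont F a"
proof -
  have "isCont (\<lambda>w. 1 - (max 1 w) powr (- (\<tau> - 1))) a"
    by (intro continuous_intros) (auto simp: max_def)
  then show ?thesis by (simp only: F_alt)
qed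

private lemma F_right_cont: "continuous (at_right a) F"
  using F_cont continuous_at_imp_continuous_at_within by blast

private lemma F_bot: "(F \<longlongrightarrow> 0) at_bot"
  by (rule tendsto_eventually) (auto simp: eventually_at_bot_dense intro!: exI[of _ 1])

private lemma F_top: "(F \<longlongrightarrow> 1) at_top"
proof (rule Lim_transform_eventually)
  have "((\<lambda>w::real. w powr (- (\<tau> - 1))) \<longlongrightarrow> 0) at_top"
    using \<tau> by (intro tendsto_neg_powr filterlim_ident) auto
  then show "((\<lambda>w::real. 1 - w powr (- (\<tau> - 1))) \<longlongrightarrow> 1) at_top"
    using tendsto_diff[OF tendsto_const] by (metis (no_types) diff_zero)
  show "\<forall>\<^sub>F w in at_top. 1 - w powr (- (\<tau> - 1)) = F w"
    using eventually_ge_at_top[of "1::real"] by eventually_elim auto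
qed

lemma real_distribution_weight_law: "real_distribution (weight_law \<tau>)"
  unfolding weight_law_def
  by (rule real_distribution_interval_measure[OF F_mono F_right_cont F_bot F_top])

lemma prob_space_weight_law: "prob_space (weight_law \<tau>)"
  using real_distribution_weight_law real_distribution.axioms(1) by blast

lemma weight_law_tail:
  assumes "w \<ge> 1"
  shows "measure (weight_law \<tau>) {w..} = w powr (- (\<tau> - 1))"
proof -
  interpret real_distribution "weight_law \<tau>" by (rule real_distribution_weight_law)
  have cdf: "cdf (weight_law \<tau>) = F"
    unfolding weight_law_def
    by (rule cdf_interval_measure) (fact F_mono F_right_cont F_bot F_top)+
  have "measure (weight_law \<tau>) {w} = 0"
    using isCont_cdf[of w] F_cont[of w] cdf by simp
  moreover have "measure (weight_law \<tau>) {..w} = F w"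
    using cdf by (simp add: cdf_def fun_eq_iff)
  moreover have "{..<w} = {..w} - {w}" by auto
  ultimately have "measure (weight_law \<tau>) {..<w} = F w"
    by (simp add: finite_measure_Diff)
  moreover have "{w..} = space (weight_law \<tau>) - {..<w}" by auto
  then have "measure (weight_law \<tau>) {w..} = 1 - measure (weight_law \<tau>) {..<w}"
    by (simp only:) (rule prob_compl, simp)
  ultimately show ?thesis
    using assms by simp
qed

lemma prob_space_weights_law: "prob_space (weights_law \<tau>)"
  unfolding weights_law_def by (intro prob_space_PiM prob_space_weight_law)

end

lemma sets_weight_law [measurable_cong]: "sets (weight_law \<tau>) = sets borel"
  by (simp add: weight_law_def)

lemma space_weights_law: "space (weights_law \<tau>) = UNIV"
  by (simp add: weights_law_def weight_law_def space_PiM)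

lemma sets_edges_law: "sets (edges_law \<alpha> lam W) = sets edge_config_space"
  unfolding edges_law_def edge_config_space_def by (intro sets_PiM_cong) auto

lemma prob_space_edges_law: "prob_space (edges_law \<alpha> lam W)"
  unfolding edges_law_def by (intro prob_space_PiM prob_space_measure_pmf)

lemma measurable_edge_prob:
  assumes "e \<in> lattice_edges"
  shows "(\<lambda>W. edge_prob \<alpha> lam W e) \<in> borel_measurable (weights_law \<tau>)"
proof -
  obtain x y where e: "e = {x, y}" "x \<noteq> y"
    using assms by (auto simp: lattice_edges_def)
  have [measurable]: "(\<lambda>W. W z) \<in> borel_measurable (weights_law \<tau>)" for z :: "int ^ 'd"
    unfolding weights_law_def
    using measurable_component_singleton[of z UNIV "\<lambda>_. weight_law \<tau>"]
    by (simp add: measurable_cong_sets[OF refl sets_weight_law])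
  show ?thesis
    unfolding e edge_prob_doubleton[OF e(2)] connection_prob_def by measurable
qed

lemma emeasure_bernoulli_pmf_eq:
  "emeasure (measure_pmf (bernoulli_pmf p)) A =
     ennreal (min 1 (max 0 p)) * indicator A True + ennreal (1 - min 1 (max 0 p)) * indicator A False"
proof -
  have "A = {} \<or> A = {True} \<or> A = {False} \<or> A = {True, False}"
    unfolding set_eq_iff all_bool_eq by auto
  then show ?thesis
    by (elim disjE) (simp_all add: emeasure_measure_pmf_finite bernoulli_pmf.rep_eq
        ennreal_plus[symmetric] del: ennreal_plus)
qed

lemma measurable_edges_law:
  "edges_law \<alpha> lam \<in> weights_law \<tau> \<rightarrow>\<^sub>M prob_algebra edge_config_space"
proof (rule measurable_prob_algebra_generated)
  let ?P = "\<lambda>e::(int ^ 'd) set. count_space (UNIV :: bool set)"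
  show "sets edge_config_space =
      sigma_sets (\<Pi>\<^sub>E e\<in>(lattice_edges :: (int ^ 'd) set set). space (?P e)) (prod_algebra lattice_edges ?P)"
    by (simp only: edge_config_space_def sets_PiM)
  show "Int_stable (prod_algebra (lattice_edges :: (int ^ 'd) set set) ?P)"
    by (rule Int_stable_prod_algebra)
  show "prod_algebra lattice_edges ?P \<subseteq> Pow (\<Pi>\<^sub>E e\<in>lattice_edges. space (?P e))"
    by (rule prod_algebra_sets_into_space)
  fix A :: "((int ^ 'd) set \<Rightarrow> bool) set"
  assume "A \<in> prod_algebra lattice_edges ?P"
  then obtain J X where A: "A = prod_emb lattice_edges ?P J (Pi\<^sub>E J X)"
    and J: "finite J" "J \<subseteq> lattice_edges"
    by (auto elim!: prod_algebraE)
  have "emeasure (edges_law \<alpha> lam W) A =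
      (\<Prod>e\<in>J. emeasure (measure_pmf (bernoulli_pmf (edge_prob \<alpha> lam W e))) (X e))"
    for W :: "int ^ 'd \<Rightarrow> real"
  proof -
    have "A = prod_emb lattice_edges (\<lambda>e. measure_pmf (bernoulli_pmf (edge_prob \<alpha> lam W e))) J (Pi\<^sub>E J X)"
      by (simp add: A prod_emb_def)
    then show ?thesis
      unfolding edges_law_def using J
      by (simp add: emeasure_PiM_emb prob_space_measure_pmf)
  qed
  moreover have "(\<lambda>W. \<Prod>e\<in>J. emeasure (measure_pmf (bernoulli_pmf (edge_prob \<alpha> lam W e))) (X e))
      \<in> borel_measurable (weights_law \<tau>)"
  proof (rule borel_measurable_prod_ennreal)
    fix e assume "e \<in> J"
    then have [measurable]: "(\<lambda>W. edge_prob \<alpha> lam W e) \<in> borel_measurable (weights_law \<tau>)"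
      using J by (intro measurable_edge_prob) auto
    show "(\<lambda>W. emeasure (measure_pmf (bernoulli_pmf (edge_prob \<alpha> lam W e))) (X e))
        \<in> borel_measurable (weights_law \<tau>)"
      unfolding emeasure_bernoulli_pmf_eq by measurable
  qed
  ultimately show "(\<lambda>W. emeasure (edges_law \<alpha> lam W) A) \<in> borel_measurable (weights_law \<tau>)"
    by simp
qed (auto simp: prob_space_edges_law sets_edges_law)

lemma measurable_sfp_kernel:
  "(\<lambda>W. distr (edges_law \<alpha> lam W) (weights_law \<tau> \<Otimes>\<^sub>M edge_config_space) (Pair W))
     \<in> weights_law \<tau> \<rightarrow>\<^sub>M prob_algebra (weights_law \<tau> \<Otimes>\<^sub>M edge_config_space)"
  by (rule measurable_distr_prob_space2[OF measurable_edges_law]) simp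

context
  fixes \<tau> :: real
  assumes \<tau>: "\<tau> > 1"
begin

private lemma weights_in: "weights_law \<tau> \<in> space (prob_algebra (weights_law \<tau>))"
  using prob_space_weights_law[OF \<tau>] by (simp add: space_prob_algebra)

lemma prob_space_sfp: "prob_space (sfp \<tau> \<alpha> lam)"
  unfolding sfp_def by (rule prob_space_bind'[OF weights_in measurable_sfp_kernel])

lemma sets_sfp: "sets (sfp \<tau> \<alpha> lam) = sets (weights_law \<tau> \<Otimes>\<^sub>M edge_config_space)"
  unfolding sfp_def by (rule sets_bind'[OF weights_in measurable_sfp_kernel])

lemma emeasure_sfp:
  fixes B :: "((int ^ 'd \<Rightarrow> real) \<times> ((int ^ 'd) set \<Rightarrow> bool)) set"
  assumes "B \<in> sets (weights_law \<tau> \<Otimes>\<^sub>M edge_config_space)"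
  shows "emeasure (sfp \<tau> \<alpha> lam) B =
    (\<integral>\<^sup>+W. emeasure (edges_law \<alpha> lam W) (Pair W -` B) \<partial>weights_law \<tau>)"
proof -
  have "emeasure (sfp \<tau> \<alpha> lam) B = (\<integral>\<^sup>+W. emeasure (distr (edges_law \<alpha> lam W)
      (weights_law \<tau> \<Otimes>\<^sub>M edge_config_space) (Pair W)) B \<partial>weights_law \<tau>)"
    unfolding sfp_def by (rule emeasure_bind_prob_algebra[OF weights_in measurable_sfp_kernel assms])
  also have "\<dots> = (\<integral>\<^sup>+W. emeasure (edges_law \<alpha> lam W) (Pair W -` B) \<partial>weights_law \<tau>)"
  proof (rule nn_integral_cong)
    fix W :: "int ^ 'd \<Rightarrow> real"
    have meas: "Pair W \<in> edges_law \<alpha> lam W \<rightarrow>\<^sub>M weights_law \<tau> \<Otimes>\<^sub>M edge_config_space"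
      unfolding measurable_cong_sets[OF sets_edges_law refl]
      by (intro measurable_Pair1') (simp add: space_weights_law)
    have "Pair W -` B \<inter> space (edges_law \<alpha> lam W) = Pair W -` B"
      using sets.sets_into_space[OF assms] sets_eq_imp_space_eq[OF sets_edges_law[of \<alpha> lam W]]
      by (auto simp: space_pair_measure)
    then show "emeasure (distr (edges_law \<alpha> lam W) (weights_law \<tau> \<Otimes>\<^sub>M edge_config_space) (Pair W)) B
        = emeasure (edges_law \<alpha> lam W) (Pair W -` B)"
      by (simp add: emeasure_distr[OF meas assms])
  qed
  finally show ?thesis .
qed

end

lemma measurable_edge_open:
  "Measurable.pred (weights_law \<tau> \<Otimes>\<^sub>M edge_config_space) (\<lambda>\<omega>. e \<in> open_edges \<omega> \<union> E)"
proof (cases "e \<in> lattice_edges")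
  case True
  then have "(\<lambda>\<eta>. \<eta> e) \<in> edge_config_space \<rightarrow>\<^sub>M count_space UNIV"
    unfolding edge_config_space_def by (rule measurable_component_singleton)
  then have [measurable]: "Measurable.pred edge_config_space (\<lambda>\<eta>. \<eta> e)"
    by simp
  show ?thesis using True by (simp add: open_edges_def)
qed (simp add: open_edges_def)

lemma measurable_open_path:
  "Measurable.pred (weights_law \<tau> \<Otimes>\<^sub>M edge_config_space)
     (\<lambda>\<omega>. open_path (open_edges \<omega> \<union> E) xs x y)"
proof -
  note measurable_edge_open [measurable]
  have [measurable]: "Measurable.pred (weights_law \<tau> \<Otimes>\<^sub>M edge_config_space)
      (\<lambda>\<omega>. successively (\<lambda>u v. {u, v} \<in> open_edges \<omega> \<union> E) xs)"
  proof (induction xs rule: induct_list012)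
    case (3 u v xs)
    then show ?case by (simp only: successively.simps(3)) measurable
  qed simp_all
  show ?thesis unfolding open_path_def by measurable
qed

lemma graph_dist_le_iff:
  "ereal_of_enat (graph_dist E x y) \<le> ereal c \<longleftrightarrow>
     (\<exists>xs. open_path E xs x y \<and> real (length xs - 1) \<le> c)"
proof
  assume le: "ereal_of_enat (graph_dist E x y) \<le> ereal c"
  let ?L = "(\<lambda>xs. enat (length xs - 1)) ` {xs. open_path E xs x y}"
  have "?L \<noteq> {}"
  proof
    assume "?L = {}"
    then have "graph_dist E x y = \<infinity>"
      by (simp add: graph_dist_def top_enat_def)
    then show False using le by simp
  qed
  then have "graph_dist E x y \<in> ?L"
    unfolding graph_dist_def by (metis (no_types, lifting) Inf_enat_def LeastI_ex ex_in_conv)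
  then show "\<exists>xs. open_path E xs x y \<and> real (length xs - 1) \<le> c"
    using le by auto
next
  assume "\<exists>xs. open_path E xs x y \<and> real (length xs - 1) \<le> c"
  then obtain xs where xs: "open_path E xs x y" "real (length xs - 1) \<le> c" by blast
  have "graph_dist E x y \<le> enat (length xs - 1)"
    unfolding graph_dist_def using xs(1) by (intro INF_lower) simp
  then have "ereal_of_enat (graph_dist E x y) \<le> ereal_of_enat (enat (length xs - 1))"
    by (simp only: ereal_of_enat_le_iff)
  also have "\<dots> \<le> ereal c" using xs(2) by simp
  finally show "ereal_of_enat (graph_dist E x y) \<le> ereal c" .
qed

lemma measurable_graph_dist_le:
  "Measurable.pred (weights_law \<tau> \<Otimes>\<^sub>M edge_config_space)
     (\<lambda>\<omega>. ereal_of_enat (graph_dist (open_edges \<omega> \<union> E) x y) \<le> ereal c)"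
proof -
  note measurable_open_path [measurable]
  show ?thesis unfolding graph_dist_le_iff by measurable
qed

lemma measurable_infinite_cluster:
  "Measurable.pred (weights_law \<tau> \<Otimes>\<^sub>M edge_config_space)
     (\<lambda>\<omega>. \<exists>x :: int ^ 'd. infinite (cluster (open_edges \<omega>) x))"
proof -
  have [measurable]: "Measurable.pred (weights_law \<tau> \<Otimes>\<^sub>M edge_config_space)
      (\<lambda>\<omega>. open_path (open_edges \<omega>) xs x y)" for xs and x y :: "int ^ 'd"
    using measurable_open_path[where E = "{}"] by simp
  have "infinite A \<longleftrightarrow> (\<forall>ys. \<exists>y. y \<in> A \<and> y \<notin> set ys)" for A :: "(int ^ 'd) set"
  proof
    assume "infinite A"
    then show "\<forall>ys. \<exists>y. y \<in> A \<and> y \<notin> set ys"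
      by (meson List.finite_set finite_subset subsetI)
  next
    assume *: "\<forall>ys. \<exists>y. y \<in> A \<and> y \<notin> set ys"
    show "infinite A"
    proof
      assume "finite A"
      then obtain ys where "set ys = A" using finite_list by blast
      then show False using * by blast
    qed
  qed
  then have eq: "(\<exists>x :: int ^ 'd. infinite (cluster (open_edges \<omega>) x)) \<longleftrightarrow>
      (\<exists>x. \<forall>ys. \<exists>y. (\<exists>xs. open_path (open_edges \<omega>) xs x y) \<and> y \<notin> set ys)" for \<omega>
    by (simp add: cluster_def)
  show ?thesis unfolding eq by measurable
qed

end

theory Submission
  imports Defs "HOL-Real_Asymp.Real_Asymp"
begin

text \<open>
  Since all weights are at least 1, given the weights the edges are independent and \<open>{x, y}\<close> is open
  with probability at least \<open>1 - exp (- lam / |x - y| powr \<alpha>)\<close>. Let \<open>\<beta> = 2 * d / \<alpha> > 1\<close> and tile the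
  lattice by nested cells whose side lengths \<open>r k\<close> satisfy \<open>ln (r k) \<ge> const * \<beta> ^ k\<close> and
  \<open>r (k + 1) \<le> r k powr \<beta>\<close> up to a logarithmic factor. Then two cells of level \<open>k\<close> inside one cell of
  level \<open>k + 1\<close> fail to be joined by an open edge with probability at most \<open>(d * r (k + 1)) powr (-2)\<close>,
  and on failure nearest-neighbour edges still give a path of length \<open>d * r (k + 1)\<close>. So the distance
  \<open>D\<close> of two points of a cell satisfies \<open>D (k + 1) \<le> D k + 1 + D' k\<close> with independent terms, up to an
  error with second moment at most 1. Expectations are thus of order \<open>2 ^ k = (\<beta> ^ k) powr \<Delta>\<close>, that is,
  of order \<open>ln (r k) powr \<Delta>\<close>. For concentration one bounds the second moment of the excess of \<open>D k\<close>
  over a level \<open>m k\<close> of order \<open>2 ^ k\<close>; it is at most of order \<open>(49 / 16) ^ k\<close>, which is small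
  compared to \<open>(2 ^ k)\<^sup>2\<close>, and Chebyshev's inequality applies.
\<close>

section \<open>Walks\<close>

text \<open>Unlike the self-avoiding paths of \<open>open_path\<close>, walks may revisit vertices,
  so they can be joined freely. They become paths only when a graph distance is bounded.\<close>

definition walk :: "'v set set \<Rightarrow> nat \<Rightarrow> 'v \<Rightarrow> 'v \<Rightarrow> bool" where
  "walk E n x y \<longleftrightarrow> (\<exists>xs. length xs = Suc n \<and> hd xs = x \<and> last xs = y \<and>
     successively (\<lambda>u v. {u, v} \<in> E) xs)"

lemma walk_refl: "walk E 0 x x"
  unfolding walk_def by (rule exI[of _ "[x]"]) simp

lemma walk_mono: "walk E n x y \<Longrightarrow> E \<subseteq> E' \<Longrightarrow> walk E' n x y"
  unfolding walk_def by (elim exE conjE, rule exI, intro conjI, assumption+) (erule successively_mono, blast)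

lemma walk_join:
  assumes "walk E m x u" "{u, v} \<in> E" "walk E n v y"
  shows "walk E (m + 1 + n) x y"
proof -
  obtain xs ys where
    "length xs = Suc m" "hd xs = x" "last xs = u" "successively (\<lambda>u v. {u, v} \<in> E) xs"
    "length ys = Suc n" "hd ys = v" "last ys = y" "successively (\<lambda>u v. {u, v} \<in> E) ys"
    using assms(1,3) unfolding walk_def by auto
  moreover have "xs \<noteq> []" "ys \<noteq> []" using calculation by auto
  ultimately show ?thesis
    unfolding walk_def using assms(2)
    by (intro exI[of _ "xs @ ys"]) (auto simp: successively_append_iff)
qed

lemma walk_Cons: "{x, u} \<in> E \<Longrightarrow> walk E n u y \<Longrightarrow> walk E (Suc n) x y"
  using walk_join[OF walk_refl, of x u E n y] by simp

text \<open>Loop erasure: cutting out the piece between two visits to one vertex leaves a strictly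
  shorter walk, so strong induction on the length ends with a path.\<close>

lemma walk_imp_open_path:
  assumes "walk E n x y"
  shows "\<exists>xs. open_path E xs x y \<and> length xs \<le> Suc n"
  using assms
proof (induction n rule: less_induct)
  case (less n)
  then obtain xs where xs: "length xs = Suc n" "hd xs = x" "last xs = y"
    "successively (\<lambda>u v. {u, v} \<in> E) xs"
    unfolding walk_def by auto
  show ?case
  proof (cases "distinct xs")
    case True
    then show ?thesis using xs unfolding open_path_def
      by (intro exI[of _ xs]) auto
  next
    case False
    then obtain as bs cs a where dec: "xs = as @ [a] @ bs @ [a] @ cs"
      using not_distinct_decomp by blast
    let ?ys = "as @ [a] @ cs"
    have "walk E (length ?ys - 1) x y"
      unfolding walk_def using xs dec
      by (intro exI[of _ ?ys])
        (auto simp: successively_append_iff successively_Cons hd_append split: if_splits)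
    moreover have "length ?ys - 1 < n" using xs(1) dec by simp
    ultimately obtain zs where "open_path E zs x y" "length zs \<le> Suc (length ?ys - 1)"
      using less.IH by blast
    then show ?thesis using \<open>length ?ys - 1 < n\<close> by (intro exI[of _ zs]) simp
  qed
qed

lemma graph_dist_le_walk:
  assumes "walk E n x y" "real n \<le> c"
  shows "ereal_of_enat (graph_dist E x y) \<le> ereal c"
proof -
  obtain xs where "open_path E xs x y" "length xs \<le> Suc n"
    using walk_imp_open_path[OF assms(1)] by blast
  then show ?thesis unfolding graph_dist_le_iff using assms(2)
    by (intro exI[of _ xs]) auto
qed

section \<open>Functions of finitely many independent Bernoulli variables\<close>

text \<open>Plays the role of measurability with respect to the coordinates in \<open>J\<close>. For
  finite \<open>J\<close> it already yields measurability and integrability, and for disjoint sets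
  it yields independence.\<close>

definition depends_on :: "(('e \<Rightarrow> bool) \<Rightarrow> 'b) \<Rightarrow> 'e set \<Rightarrow> bool" where
  "depends_on f J \<longleftrightarrow> (\<forall>\<omega> \<omega>'. (\<forall>e\<in>J. \<omega> e = \<omega>' e) \<longrightarrow> f \<omega> = f \<omega>')"

lemma depends_onI:
  assumes "\<And>\<omega> \<omega>'. (\<And>e. e \<in> J \<Longrightarrow> \<omega> e = \<omega>' e) \<Longrightarrow> f \<omega> = f \<omega>'"
  shows "depends_on f J"
  unfolding depends_on_def
proof (intro allI impI)
  fix \<omega> \<omega>' :: "_ \<Rightarrow> bool" assume "\<forall>e\<in>J. \<omega> e = \<omega>' e"
  then show "f \<omega> = f \<omega>'" by (intro assms) (rule bspec)
qed

lemma depends_onD: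
  assumes "depends_on f J" "\<And>e. e \<in> J \<Longrightarrow> \<omega> e = \<omega>' e"
  shows "f \<omega> = f \<omega>'"
  by (rule assms(1)[unfolded depends_on_def, THEN spec, THEN spec, THEN mp]) (rule ballI, rule assms(2))

lemma depends_on_mono:
  assumes "depends_on f J" "J \<subseteq> K"
  shows "depends_on f K"
proof (rule depends_onI)
  fix \<omega> \<omega>' :: "_ \<Rightarrow> bool" assume e: "\<And>e. e \<in> K \<Longrightarrow> \<omega> e = \<omega>' e"
  show "f \<omega> = f \<omega>'" by (rule depends_onD[OF assms(1)]) (rule e, rule subsetD[OF assms(2)])
qed

lemma depends_on_comp:
  assumes "depends_on f J"
  shows "depends_on (\<lambda>\<omega>. h (f \<omega>)) J"
proof (rule depends_onI)
  fix \<omega> \<omega>' :: "_ \<Rightarrow> bool" assume e: "\<And>e. e \<in> J \<Longrightarrow> \<omega> e = \<omega>' e"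
  show "h (f \<omega>) = h (f \<omega>')" by (rule arg_cong[OF depends_onD[OF assms e]])
qed

lemma depends_on_comp2:
  assumes "depends_on f J" "depends_on g J"
  shows "depends_on (\<lambda>\<omega>. h (f \<omega>) (g \<omega>)) J"
proof (rule depends_onI)
  fix \<omega> \<omega>' :: "_ \<Rightarrow> bool" assume e: "\<And>e. e \<in> J \<Longrightarrow> \<omega> e = \<omega>' e"
  show "h (f \<omega>) (g \<omega>) = h (f \<omega>') (g \<omega>')"
    by (rule arg_cong2[OF depends_onD[OF assms(1) e] depends_onD[OF assms(2) e]])
qed

locale bernoulli_product =
  fixes p :: "'e \<Rightarrow> real" and I :: "'e set"
  assumes p_range: "e \<in> I \<Longrightarrow> 0 \<le> p e" "e \<in> I \<Longrightarrow> p e \<le> 1"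
begin

definition "M = (\<Pi>\<^sub>M e\<in>I. measure_pmf (bernoulli_pmf (p e)))"

lemma product_prob_space: "product_prob_space (\<lambda>e. measure_pmf (bernoulli_pmf (p e)))"
  by unfold_locales (simp add: measure_pmf.emeasure_space_1)

sublocale M: prob_space M
  unfolding M_def by (rule prob_space_PiM) (rule prob_space_measure_pmf)

lemma sets_M: "sets M = sets (\<Pi>\<^sub>M e\<in>I. count_space (UNIV :: bool set))"
  unfolding M_def by (intro sets_PiM_cong) auto

lemma coordinate_measurable: "e \<in> I \<Longrightarrow> (\<lambda>\<omega>. \<omega> e) \<in> M \<rightarrow>\<^sub>M count_space UNIV"
  unfolding measurable_cong_sets[OF sets_M refl] by (rule measurable_component_singleton)

lemma restrict_measurable:
  assumes "J \<subseteq> I"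
  shows "(\<lambda>\<omega>. restrict \<omega> J) \<in> M \<rightarrow>\<^sub>M (\<Pi>\<^sub>M e\<in>J. count_space UNIV)"
  using assms by (intro measurable_restrict coordinate_measurable) auto

lemma measurable_finite_restrict:
  fixes f :: "('e \<Rightarrow> bool) \<Rightarrow> real"
  assumes "finite J"
  shows "f \<in> borel_measurable (\<Pi>\<^sub>M e\<in>J. count_space (UNIV :: bool set))"
  by (simp add: count_space_PiM_finite[OF assms])

lemma depends_on_restrict:
  assumes "depends_on f J"
  shows "f (restrict \<omega> J) = f \<omega>"
  by (rule depends_onD[OF assms]) simp

lemma depends_on_measurable:
  fixes f :: "('e \<Rightarrow> bool) \<Rightarrow> real"
  assumes "depends_on f J" "finite J" "J \<subseteq> I"
  shows "f \<in> borel_measurable M"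
proof -
  have "(\<lambda>\<omega>. f (restrict \<omega> J)) \<in> borel_measurable M"
    by (rule measurable_compose[OF restrict_measurable[OF assms(3)] measurable_finite_restrict[OF assms(2)]])
  moreover have "(\<lambda>\<omega>. f (restrict \<omega> J)) = f"
    by (rule ext) (rule depends_on_restrict[OF assms(1)])
  ultimately show ?thesis by simp
qed

text \<open>Finitely many binary coordinates admit finitely many values of \<open>f\<close>, so
  \<open>f\<close> is bounded.\<close>

lemma depends_on_integrable:
  fixes f :: "('e \<Rightarrow> bool) \<Rightarrow> real"
  assumes "depends_on f J" "finite J" "J \<subseteq> I"
  shows "integrable M f"
proof -
  have "range f \<subseteq> f ` (PiE J (\<lambda>_. UNIV))"
  proof
    fix r assume "r \<in> range f"
    then obtain \<omega> where "r = f \<omega>" by blast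
    then have "r = f (restrict \<omega> J)" by (simp only: depends_on_restrict[OF assms(1)])
    then show "r \<in> f ` (PiE J (\<lambda>_. UNIV))" by (simp add: image_eqI)
  qed
  then have "finite (range f)"
    by (rule finite_subset) (intro finite_imageI finite_PiE assms(2), simp)
  then obtain B where "\<And>\<omega>. norm (f \<omega>) \<le> B"
    using finite_imp_bounded[of "range f"] unfolding bounded_iff by blast
  then show ?thesis
    by (intro M.integrable_const_bound[of _ B] depends_on_measurable[OF assms]) auto
qed

text \<open>Independence holds once the joint law is the product of the marginals. Here the joint
  map is the identity on the product space, and the marginals are the factors.\<close>

lemma indep_coordinates:
  "M.indep_vars (\<lambda>_. count_space UNIV) (\<lambda>e \<omega>. \<omega> e) I"
proof (cases "I = {}")
  case True
  then show ?thesis unfolding M.indep_vars_def2 M.indep_sets_def by auto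
next
  case False
  show ?thesis
  proof (subst M.indep_vars_iff_distr_eq_PiM'[OF False])
    show "M.random_variable (count_space UNIV) (\<lambda>\<omega>. \<omega> e)" if "e \<in> I" for e
      by (rule coordinate_measurable[OF that])
    have "distr M (\<Pi>\<^sub>M e\<in>I. count_space UNIV) (\<lambda>\<omega>. \<lambda>e\<in>I. \<omega> e) = distr M M (\<lambda>\<omega>. \<omega>)"
      using sets_M by (intro distr_cong) (auto simp: M_def space_PiM PiE_restrict)
    also have "\<dots> = M" by (simp add: distr_id2)
    also have "M = (\<Pi>\<^sub>M e\<in>I. distr M (count_space UNIV) (\<lambda>\<omega>. \<omega> e))"
      unfolding M_def
    proof (intro PiM_cong refl)
      fix e assume "e \<in> I"
      have "distr (Pi\<^sub>M I (\<lambda>e. measure_pmf (bernoulli_pmf (p e)))) (count_space UNIV) (\<lambda>\<omega>. \<omega> e)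
        = distr (Pi\<^sub>M I (\<lambda>e. measure_pmf (bernoulli_pmf (p e)))) (measure_pmf (bernoulli_pmf (p e))) (\<lambda>\<omega>. \<omega> e)"
        by (intro distr_cong) auto
      then show "measure_pmf (bernoulli_pmf (p e)) =
        distr (Pi\<^sub>M I (\<lambda>e. measure_pmf (bernoulli_pmf (p e)))) (count_space UNIV) (\<lambda>\<omega>. \<omega> e)"
        using product_prob_space.PiM_component[OF product_prob_space \<open>e \<in> I\<close>] by simp
    qed
    finally show "distr M (\<Pi>\<^sub>M e\<in>I. count_space UNIV) (\<lambda>\<omega>. \<lambda>e\<in>I. \<omega> e) =
      (\<Pi>\<^sub>M e\<in>I. distr M (count_space UNIV) (\<lambda>\<omega>. \<omega> e))" .
  qed
qed

text \<open>Both functions factor through restrictions of the configuration to disjoint sets of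
  coordinates, and such restrictions are independent.\<close>

lemma expectation_mult:
  fixes f g :: "('e \<Rightarrow> bool) \<Rightarrow> real"
  assumes f: "depends_on f J" "finite J" "J \<subseteq> I"
    and g: "depends_on g K" "finite K" "K \<subseteq> I" and "J \<inter> K = {}"
  shows "M.expectation (\<lambda>\<omega>. f \<omega> * g \<omega>) = M.expectation f * M.expectation g"
proof (rule M.indep_var_lebesgue_integral)
  have "M.indep_var borel (f \<circ> (\<lambda>\<omega>. restrict \<omega> J)) borel (g \<circ> (\<lambda>\<omega>. restrict \<omega> K))"
    using M.indep_var_restrict[OF indep_coordinates assms(7,3,6)]
    by (rule M.indep_var_compose) (simp_all add: measurable_finite_restrict f g)
  then show "M.indep_var borel f borel g"
    by (simp add: o_def depends_on_restrict[OF f(1)] depends_on_restrict[OF g(1)])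
qed (rule depends_on_integrable[OF f], rule depends_on_integrable[OF g])

lemma prob_all_closed:
  assumes "finite J" "J \<subseteq> I"
  shows "M.expectation (\<lambda>\<omega>. of_bool (\<forall>e\<in>J. \<not> \<omega> e)) = (\<Prod>e\<in>J. 1 - p e)"
proof -
  have eq: "(\<lambda>\<omega>. of_bool (\<forall>e\<in>J. \<not> \<omega> e)) = (indicator {\<omega>. \<forall>e\<in>J. \<omega> e \<in> {False}} :: _ \<Rightarrow> real)"
    by (auto simp: indicator_def)
  have "M.expectation (\<lambda>\<omega>. of_bool (\<forall>e\<in>J. \<not> \<omega> e)) =
      measure M {\<omega> \<in> space M. \<forall>e\<in>J. \<omega> e \<in> {False}}"
    unfolding eq by (simp add: Bochner_Integration.integral_indicator Collect_conj_eq Int_commute)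
  also have "ennreal \<dots> = (\<Prod>e\<in>J. emeasure (measure_pmf (bernoulli_pmf (p e))) {False})"
    unfolding M.emeasure_eq_measure[symmetric] unfolding M_def
    using assms by (intro product_prob_space.emeasure_PiM_Collect[OF product_prob_space]) auto
  also have "\<dots> = (\<Prod>e\<in>J. ennreal (1 - p e))"
  proof (intro prod.cong refl)
    fix e assume "e \<in> J"
    then have "0 \<le> p e" "p e \<le> 1" using assms(2) p_range by auto
    then show "emeasure (measure_pmf (bernoulli_pmf (p e))) {False} = ennreal (1 - p e)"
      by (simp add: emeasure_bernoulli_pmf_eq)
  qed
  also have "\<dots> = ennreal (\<Prod>e\<in>J. 1 - p e)"
    using assms(2) p_range by (intro prod_ennreal) auto
  finally show ?thesis
    using assms(2) p_range by (subst (asm) ennreal_inj) (simp_all add: prod_nonneg subset_iff)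
qed

end

section \<open>Distances in a hierarchy of cells\<close>

text \<open>\<open>S k\<close> stands for lying in one cell of level \<open>k\<close>, and
  \<open>L k\<close> bounds the length of a detour along \<open>E0\<close> inside such a cell. The
  product in \<open>cross_rare\<close> is the probability that no edge joins two subcells;
  multiplied by the squared length of the detour it stays at most 1, so failures cost at most 1 in
  the second moment.\<close>

locale hierarchy = bernoulli_product p I
  for p :: "'v set \<Rightarrow> real" and I :: "'v set set" +
  fixes S :: "nat \<Rightarrow> 'v \<Rightarrow> 'v \<Rightarrow> bool" and L :: "nat \<Rightarrow> nat" and E0 :: "'v set set"
  assumes S_refl: "S k x x"
    and S_sym: "S k x y \<Longrightarrow> S k y x"
    and S_trans: "S k x y \<Longrightarrow> S k y z \<Longrightarrow> S k x z"
    and S_Suc: "S k x y \<Longrightarrow> S (Suc k) x y"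
    and S_finite: "finite {y. S k x y}"
    and S_edge: "S k x y \<Longrightarrow> x \<noteq> y \<Longrightarrow> {x, y} \<in> I"
    and S_walk: "S k x y \<Longrightarrow> \<exists>n\<le>L k. walk E0 n x y"
    and L_pos: "L 0 \<ge> 1"
    and cross_rare: "S (Suc k) x y \<Longrightarrow> \<not> S k x y \<Longrightarrow>
      (\<Prod>e\<in>{{u, v} | u v. S k x u \<and> S k y v}. 1 - p e) * (real (L (Suc k)))\<^sup>2 \<le> 1"
begin

section \<open>Edges inside and between cells, and the recursive distance bound\<close>

definition cross :: "nat \<Rightarrow> 'v \<Rightarrow> 'v \<Rightarrow> 'v set set" where
  "cross k x y = {{u, v} | u v. S k x u \<and> S k y v}"

definition inner :: "nat \<Rightarrow> 'v \<Rightarrow> 'v set set" where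
  "inner k x = {{u, v} | u v. u \<noteq> v \<and> S k x u \<and> S k x v}"

definition bridges :: "nat \<Rightarrow> ('v set \<Rightarrow> bool) \<Rightarrow> 'v \<Rightarrow> 'v \<Rightarrow> ('v \<times> 'v) set" where
  "bridges k \<omega> x y = {(u, v). S k x u \<and> S k y v \<and> \<omega> {u, v}}"

text \<open>The choice is a function of the set of bridges alone, hence of the edges in
  \<open>cross k x y\<close>. It reveals nothing about the edges inside the two subcells.\<close>

definition bridge :: "nat \<Rightarrow> ('v set \<Rightarrow> bool) \<Rightarrow> 'v \<Rightarrow> 'v \<Rightarrow> 'v \<times> 'v" where
  "bridge k \<omega> x y = (SOME q. q \<in> bridges k \<omega> x y)"

text \<open>
  A random upper bound for the distance of two vertices of one level-\<open>k\<close> cell, which by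
  construction only depends on the edges inside that cell. A bridge between the two subcells
  splits the distance into two independent parts; without a bridge one walks along \<open>E0\<close>.
\<close>

primrec T :: "nat \<Rightarrow> ('v set \<Rightarrow> bool) \<Rightarrow> 'v \<Rightarrow> 'v \<Rightarrow> nat" where
  "T 0 \<omega> x y = (LEAST n. walk E0 n x y)"
| "T (Suc k) \<omega> x y =
    (if S k x y then T k \<omega> x y
     else if bridges k \<omega> x y = {} then (LEAST n. walk E0 n x y)
     else T k \<omega> x (fst (bridge k \<omega> x y)) + 1 + T k \<omega> (snd (bridge k \<omega> x y)) y)"

lemma least_walk:
  assumes "S k x y"
  shows "walk E0 (LEAST n. walk E0 n x y) x y" "(LEAST n. walk E0 n x y) \<le> L k"
proof -
  obtain n where "n \<le> L k" "walk E0 n x y" using S_walk[OF assms] by blast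
  then show "walk E0 (LEAST n. walk E0 n x y) x y" "(LEAST n. walk E0 n x y) \<le> L k"
    by (auto intro: LeastI Least_le order_trans)
qed

lemma bridge_in: "bridges k \<omega> x y \<noteq> {} \<Longrightarrow> bridge k \<omega> x y \<in> bridges k \<omega> x y"
  unfolding bridge_def by (rule someI_ex) blast

lemma bridgeD:
  assumes "bridges k \<omega> x y \<noteq> {}" "bridge k \<omega> x y = (u, v)"
  shows "S k x u" "S k y v" "\<omega> {u, v}"
  using bridge_in[OF assms(1)] assms(2) by (auto simp: bridges_def)

lemma inner_eq:
  assumes "S k x y"
  shows "inner k x = inner k y"
proof -
  have "S k x u \<longleftrightarrow> S k y u" for u using assms S_sym S_trans by blast
  then show ?thesis by (simp add: inner_def)
qed

lemma inner_Suc: "inner k x \<subseteq> inner (Suc k) x"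
  unfolding inner_def using S_Suc by blast

lemma cross_subset_inner:
  assumes "S (Suc k) x y" "\<not> S k x y"
  shows "cross k x y \<subseteq> inner (Suc k) x"
proof -
  have "u \<noteq> v \<and> S (Suc k) x u \<and> S (Suc k) x v" if "S k x u" "S k y v" for u v
    using assms that S_Suc S_trans S_sym by blast
  then show ?thesis unfolding cross_def inner_def by blast
qed

lemma finite_inner: "finite (inner k x)"
proof (rule finite_subset)
  show "inner k x \<subseteq> (\<lambda>(u, v). {u, v}) ` ({y. S k x y} \<times> {y. S k x y})"
    unfolding inner_def by auto
qed (intro finite_imageI finite_cartesian_product S_finite)

lemma inner_subset: "inner k x \<subseteq> I"
  unfolding inner_def using S_edge S_trans S_sym by blast

text \<open>Distinct cells share no vertex, and a crossing edge has one endpoint in each. This makes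
  the selected bridge independent of the distances within the subcells.\<close>

lemma cross_inner_disjoint:
  assumes "\<not> S k x y"
  shows "cross k x y \<inter> (inner k x \<union> inner k y) = {}"
proof -
  have "\<not> (S k x z \<and> S k y z)" for z using assms S_trans S_sym by blast
  then show ?thesis unfolding cross_def inner_def by (auto simp: doubleton_eq_iff)
qed

text \<open>Source of the independence of the two parts on either side of a bridge.\<close>

lemma inner_inner_disjoint:
  assumes "\<not> S k x y"
  shows "inner k x \<inter> inner k y = {}"
proof -
  have "\<not> (S k x z \<and> S k y z)" for z using assms S_trans S_sym by blast
  then show ?thesis unfolding inner_def by (auto simp: doubleton_eq_iff)
qed

lemma bridges_depends: "depends_on (\<lambda>\<omega>. bridges k \<omega> x y) (cross k x y)"
proof (rule depends_onI)
  fix \<omega> \<omega>' :: "'v set \<Rightarrow> bool" assume "\<And>e. e \<in> cross k x y \<Longrightarrow> \<omega> e = \<omega>' e"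
  then have "\<omega> {u, v} = \<omega>' {u, v}" if "S k x u" "S k y v" for u v
    using that unfolding cross_def by blast
  then show "bridges k \<omega> x y = bridges k \<omega>' x y" unfolding bridges_def by auto
qed

text \<open>At level \<open>k + 1\<close> the bridge is read off the crossing edges and the two
  recursive terms off the edges of the subcells; all of these lie inside the larger cell.\<close>

lemma T_depends: "S k x y \<Longrightarrow> depends_on (\<lambda>\<omega>. T k \<omega> x y) (inner k x)"
proof (induction k arbitrary: x y)
  case 0
  show ?case by (rule depends_onI) simp
next
  case (Suc k)
  show ?case
  proof (cases "S k x y")
    case True
    then show ?thesis
      using depends_on_mono[OF Suc.IH[OF True] inner_Suc] by simp
  next
    case False
    show ?thesis
    proof (rule depends_onI)
      fix \<omega> \<omega>' :: "'v set \<Rightarrow> bool"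
      assume agree: "\<And>e. e \<in> inner (Suc k) x \<Longrightarrow> \<omega> e = \<omega>' e"
      have b: "bridges k \<omega> x y = bridges k \<omega>' x y"
        by (rule depends_onD[OF bridges_depends])
          (rule agree, rule subsetD[OF cross_subset_inner[OF Suc.prems False]])
      then have b': "bridge k \<omega> x y = bridge k \<omega>' x y" by (simp add: bridge_def)
      show "T (Suc k) \<omega> x y = T (Suc k) \<omega>' x y"
      proof (cases "bridges k \<omega> x y = {}")
        case True
        then show ?thesis using False b by simp
      next
        case ne: False
        obtain u v where uv: "bridge k \<omega> x y = (u, v)" by fastforce
        note S_uv = bridgeD[OF ne uv]
        have "T k \<omega> x u = T k \<omega>' x u"
          by (rule depends_onD[OF Suc.IH[OF S_uv(1)]]) (rule agree, rule subsetD[OF inner_Suc])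
        moreover have "inner k v \<subseteq> inner (Suc k) x"
          using inner_Suc[of k v] inner_eq[OF S_trans[OF Suc.prems S_Suc[OF S_uv(2)]]] by simp
        then have "T k \<omega> v y = T k \<omega>' v y"
          by (intro depends_onD[OF Suc.IH[OF S_sym[OF S_uv(2)]]]) (rule agree, rule subsetD)
        ultimately show ?thesis using False ne uv b b' by simp
      qed
    qed
  qed
qed

lemma T_walk:
  assumes "S k x y"
  shows "walk ({e \<in> I. \<omega> e} \<union> E0) (T k \<omega> x y) x y"
  using assms
proof (induction k arbitrary: x y)
  case 0
  then show ?case using walk_mono[OF least_walk(1)[OF 0]] by simp
next
  case (Suc k)
  consider "S k x y" | "\<not> S k x y" "bridges k \<omega> x y = {}" | "\<not> S k x y" "bridges k \<omega> x y \<noteq> {}"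
    by blast
  then show ?case
  proof cases
    case 1
    then show ?thesis using Suc.IH by simp
  next
    case 2
    then show ?thesis using walk_mono[OF least_walk(1)[OF Suc.prems]] by simp
  next
    case 3
    obtain u v where uv: "bridge k \<omega> x y = (u, v)" by fastforce
    note S_uv = bridgeD[OF 3(2) uv]
    have "{u, v} \<in> cross k x y" using S_uv unfolding cross_def by blast
    then have "{u, v} \<in> I"
      using cross_subset_inner[OF Suc.prems 3(1)] inner_subset by blast
    then have "walk ({e \<in> I. \<omega> e} \<union> E0) (T k \<omega> x u + 1 + T k \<omega> v y) x y"
      using S_uv by (intro walk_join[OF Suc.IH _ Suc.IH[OF S_sym]]) auto
    then show ?thesis using 3 uv by simp
  qed
qed

section \<open>Second moment of the excess over the level \<open>m k\<close>\<close>

definition \<delta> :: "nat \<Rightarrow> real" where "\<delta> k = 2 * (7 / 4) ^ k"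

text \<open>
  The solution of \<open>m (k + 1) = 2 * m k + 1 + \<delta> k\<close> with \<open>m 0 = L 0\<close>. The slack \<open>\<delta> k\<close> grows
  more slowly than \<open>2 ^ k\<close>, so that \<open>m\<close> keeps the order \<open>2 ^ k\<close>, while \<open>7 / 4 > sqrt (5 / 2)\<close>
  matches the factor \<open>5 / 2\<close> by which the second moment of the excess over \<open>m k\<close> may grow per level.
\<close>

definition m :: "nat \<Rightarrow> real" where "m k = (real (L 0) + 9) * 2 ^ k - 8 * (7 / 4) ^ k - 1"

lemma m_Suc: "m (Suc k) = 2 * m k + 1 + \<delta> k"
  by (simp add: m_def \<delta>_def algebra_simps)

lemma \<delta>_ge: "\<delta> k \<ge> 2"
  by (simp add: \<delta>_def)

lemma m_ge: "m k \<ge> 2 ^ k"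
proof -
  have "(7 / 4 :: real) ^ k \<le> 2 ^ k" by (intro power_mono) auto
  moreover have "(1 :: real) \<le> 2 ^ k" by simp
  moreover have "1 * 2 ^ k \<le> real (L 0) * 2 ^ k" using L_pos by (intro mult_right_mono) auto
  ultimately show ?thesis unfolding m_def distrib_right by linarith
qed

definition X :: "nat \<Rightarrow> ('v set \<Rightarrow> bool) \<Rightarrow> 'v \<Rightarrow> 'v \<Rightarrow> real" where
  "X k \<omega> x y = max 0 (real (T k \<omega> x y) - m k)"

text \<open>The slack \<open>\<delta> k\<close> in \<open>m_Suc\<close> is shared equally by the two
  parts of a path through a bridge; this is what remains of the excess of one part.\<close>

definition Y :: "nat \<Rightarrow> ('v set \<Rightarrow> bool) \<Rightarrow> 'v \<Rightarrow> 'v \<Rightarrow> real" where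
  "Y k \<omega> x y = max 0 (X k \<omega> x y - \<delta> k / 2)"

text \<open>The last bound is the nonnegative square of \<open>X - \<delta>\<close> expanded:
  subtracting the slack lets a second moment control a first moment.\<close>

lemma Y_le:
  "0 \<le> Y k \<omega> x y" "(Y k \<omega> x y)\<^sup>2 \<le> (X k \<omega> x y)\<^sup>2" "Y k \<omega> x y \<le> (X k \<omega> x y)\<^sup>2 / (2 * \<delta> k)"
proof -
  have d: "\<delta> k > 0" using \<delta>_ge[of k] by simp
  have x: "X k \<omega> x y \<ge> 0" by (simp add: X_def)
  show "0 \<le> Y k \<omega> x y" by (simp add: Y_def)
  show "(Y k \<omega> x y)\<^sup>2 \<le> (X k \<omega> x y)\<^sup>2"
    using x d by (intro power_mono) (auto simp: Y_def)
  have "0 \<le> (X k \<omega> x y - \<delta> k)\<^sup>2" by simp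
  then have "(X k \<omega> x y - \<delta> k / 2) * (2 * \<delta> k) \<le> (X k \<omega> x y)\<^sup>2"
    by (simp add: power2_eq_square algebra_simps)
  then have "X k \<omega> x y - \<delta> k / 2 \<le> (X k \<omega> x y)\<^sup>2 / (2 * \<delta> k)"
    using d by (simp add: pos_le_divide_eq)
  then show "Y k \<omega> x y \<le> (X k \<omega> x y)\<^sup>2 / (2 * \<delta> k)"
    using d by (simp add: Y_def)
qed

lemma X_depends: "S k x y \<Longrightarrow> depends_on (\<lambda>\<omega>. X k \<omega> x y) (inner k x)"
  unfolding X_def by (rule depends_on_comp[OF T_depends])

lemma Y_depends: "S k x y \<Longrightarrow> depends_on (\<lambda>\<omega>. Y k \<omega> x y) (inner k x)"
  unfolding Y_def by (rule depends_on_comp[OF X_depends])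

text \<open>The summand 1 in \<open>m_Suc\<close> pays for the bridge itself, and
  \<open>\<delta> k\<close> for the halves subtracted in the two copies of \<open>Y\<close>.\<close>

lemma X_Suc_bridge:
  assumes "\<not> S k x y" "bridges k \<omega> x y \<noteq> {}" "bridge k \<omega> x y = (u, v)"
  shows "X (Suc k) \<omega> x y \<le> Y k \<omega> x u + Y k \<omega> v y"
  using assms by (simp add: X_def Y_def m_Suc max_def)

lemma X_Suc_no_bridge:
  assumes "\<not> S k x y" "bridges k \<omega> x y = {}" "S (Suc k) x y"
  shows "X (Suc k) \<omega> x y \<le> real (L (Suc k))"
proof -
  have "(0 :: real) \<le> 2 ^ Suc k" by simp
  then have "m (Suc k) \<ge> 0" using m_ge[of "Suc k"] by linarith
  then show ?thesis using assms least_walk(2)[OF assms(3)] by (simp add: X_def)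
qed

lemma inner_integrable:
  fixes f :: "('v set \<Rightarrow> bool) \<Rightarrow> real"
  shows "depends_on f (inner k x) \<Longrightarrow> integrable M f"
  by (rule depends_on_integrable[OF _ finite_inner inner_subset])

text \<open>
  Two independent excesses add up to at most twice the second moment plus the product of the
  means; because of the slack the means are bounded by second moments (\<open>Y_le\<close>), so no factor 4 occurs.
\<close>

lemma Y_moment:
  assumes ns: "\<not> S k x y" and "S k x u" "S k y v"
    and IH: "\<And>x y. S k x y \<Longrightarrow> M.expectation (\<lambda>\<omega>. (X k \<omega> x y)\<^sup>2) \<le> (\<delta> k)\<^sup>2"
  shows "M.expectation (\<lambda>\<omega>. (Y k \<omega> x u + Y k \<omega> v y)\<^sup>2) \<le> 5 / 2 * (\<delta> k)\<^sup>2"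
proof -
  have d: "\<delta> k > 0" using \<delta>_ge[of k] by simp
  have S_vy: "S k v y" using S_sym assms(3) by blast
  have moments: "M.expectation (\<lambda>\<omega>. (Y k \<omega> w z)\<^sup>2) \<le> (\<delta> k)\<^sup>2"
      "0 \<le> M.expectation (\<lambda>\<omega>. Y k \<omega> w z)" "M.expectation (\<lambda>\<omega>. Y k \<omega> w z) \<le> \<delta> k / 2"
      "integrable M (\<lambda>\<omega>. (Y k \<omega> w z)\<^sup>2)" "integrable M (\<lambda>\<omega>. Y k \<omega> w z)"
    if "S k w z" for w z
  proof -
    have X2: "integrable M (\<lambda>\<omega>. (X k \<omega> w z)\<^sup>2)"
      by (rule inner_integrable[OF depends_on_comp[OF X_depends[OF that]]])
    show Y2: "integrable M (\<lambda>\<omega>. (Y k \<omega> w z)\<^sup>2)"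
      by (rule inner_integrable[OF depends_on_comp[OF Y_depends[OF that]]])
    show Y1: "integrable M (\<lambda>\<omega>. Y k \<omega> w z)"
      by (rule inner_integrable[OF Y_depends[OF that]])
    have "M.expectation (\<lambda>\<omega>. (Y k \<omega> w z)\<^sup>2) \<le> M.expectation (\<lambda>\<omega>. (X k \<omega> w z)\<^sup>2)"
      by (rule integral_mono[OF Y2 X2 Y_le(2)])
    then show "M.expectation (\<lambda>\<omega>. (Y k \<omega> w z)\<^sup>2) \<le> (\<delta> k)\<^sup>2" using IH[OF that] by simp
    show "0 \<le> M.expectation (\<lambda>\<omega>. Y k \<omega> w z)" by (simp add: Y_le(1))
    have "M.expectation (\<lambda>\<omega>. Y k \<omega> w z) \<le> M.expectation (\<lambda>\<omega>. (X k \<omega> w z)\<^sup>2 / (2 * \<delta> k))"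
      using X2 by (intro integral_mono[OF Y1 _ Y_le(3)]) simp
    also have "\<dots> = M.expectation (\<lambda>\<omega>. (X k \<omega> w z)\<^sup>2) / (2 * \<delta> k)" by simp
    also have "\<dots> \<le> (\<delta> k)\<^sup>2 / (2 * \<delta> k)" using IH[OF that] d by (intro divide_right_mono) auto
    also have "\<dots> = \<delta> k / 2" using d by (simp add: power2_eq_square)
    finally show "M.expectation (\<lambda>\<omega>. Y k \<omega> w z) \<le> \<delta> k / 2" .
  qed
  note U = moments[OF assms(2)] and V = moments[OF S_vy]
  have "inner k v = inner k y" using inner_eq[OF S_vy] .
  then have dep_v: "depends_on (\<lambda>\<omega>. Y k \<omega> v y) (inner k y)" using Y_depends[OF S_vy] by simp
  have prod: "M.expectation (\<lambda>\<omega>. Y k \<omega> x u * Y k \<omega> v y) =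
      M.expectation (\<lambda>\<omega>. Y k \<omega> x u) * M.expectation (\<lambda>\<omega>. Y k \<omega> v y)"
    by (rule expectation_mult[OF Y_depends[OF assms(2)] finite_inner inner_subset dep_v
          finite_inner inner_subset inner_inner_disjoint[OF ns]])
  have int: "integrable M (\<lambda>\<omega>. Y k \<omega> x u * Y k \<omega> v y)"
    by (rule depends_on_integrable[OF depends_on_comp2[where J = "inner k x \<union> inner k y"]])
      (auto intro: depends_on_mono[OF Y_depends[OF assms(2)]] depends_on_mono[OF dep_v]
        simp: finite_inner subsetD[OF inner_subset])
  have "M.expectation (\<lambda>\<omega>. (Y k \<omega> x u + Y k \<omega> v y)\<^sup>2) =
      M.expectation (\<lambda>\<omega>. (Y k \<omega> x u)\<^sup>2 + (Y k \<omega> v y)\<^sup>2 + 2 * (Y k \<omega> x u * Y k \<omega> v y))"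
    by (simp add: power2_sum mult.assoc)
  also have "\<dots> = M.expectation (\<lambda>\<omega>. (Y k \<omega> x u)\<^sup>2) + M.expectation (\<lambda>\<omega>. (Y k \<omega> v y)\<^sup>2)
      + 2 * (M.expectation (\<lambda>\<omega>. Y k \<omega> x u) * M.expectation (\<lambda>\<omega>. Y k \<omega> v y))"
    using U(4) V(4) int by (simp add: prod)
  also have "\<dots> \<le> (\<delta> k)\<^sup>2 + (\<delta> k)\<^sup>2 + 2 * (\<delta> k / 2 * (\<delta> k / 2))"
    using U V d by (intro add_mono mult_left_mono mult_mono) auto
  also have "\<dots> = 5 / 2 * (\<delta> k)\<^sup>2" by (simp add: power2_eq_square)
  finally show ?thesis .
qed

text \<open>Decompose according to the selected bridge. The selection is independent of the excesses
  in the subcells, so \<open>Y_moment\<close> applies for each fixed bridge, and the selection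
  probabilities sum to at most 1. This gives the factor 5/2; the absence of a bridge adds at most 1
  by \<open>cross_rare\<close>.\<close>

lemma moment:
  assumes "S k x y"
  shows "M.expectation (\<lambda>\<omega>. (X k \<omega> x y)\<^sup>2) \<le> (\<delta> k)\<^sup>2"
  using assms
proof (induction k arbitrary: x y)
  case 0
  \<comment> \<open>There is no excess at the bottom level because \<open>m 0 = L 0\<close>.\<close>
  have "X 0 \<omega> x y = 0" for \<omega>
    using least_walk(2)[OF 0] by (simp add: X_def m_def)
  then show ?case by simp
next
  case (Suc k)
  show ?case
  proof (cases "S k x y")
    case True
    have d: "\<delta> k \<ge> 2" by (rule \<delta>_ge)
    \<comment> \<open>Within one subcell \<open>T\<close> does not change, while the level
      \<open>m\<close> only rises.\<close>
    have "0 \<le> m k" using m_ge[of k] by (rule order_trans[rotated]) simp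
    then have "m k \<le> m (Suc k)" using d by (simp add: m_Suc)
    then have le: "(X (Suc k) \<omega> x y)\<^sup>2 \<le> (X k \<omega> x y)\<^sup>2" for \<omega>
      using True by (intro power_mono) (auto simp: X_def)
    have "M.expectation (\<lambda>\<omega>. (X (Suc k) \<omega> x y)\<^sup>2) \<le> M.expectation (\<lambda>\<omega>. (X k \<omega> x y)\<^sup>2)"
      by (rule integral_mono[OF _ _ le])
        (rule inner_integrable[OF depends_on_comp[OF X_depends]], fact)+
    also have "\<dots> \<le> (\<delta> k)\<^sup>2" by (rule Suc.IH[OF True])
    also have "\<dots> \<le> (\<delta> (Suc k))\<^sup>2" using d by (intro power_mono) (auto simp: \<delta>_def)
    finally show ?thesis .
  next
    case ns: False
    let ?Q = "{u. S k x u} \<times> {v. S k y v}"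
    have fQ: "finite ?Q" by (intro finite_cartesian_product S_finite)
    \<comment> \<open>\<open>c q\<close> indicates that \<open>q\<close> is the selected bridge,
      \<open>c0\<close> that there is none; \<open>h q\<close> bounds the squared excess when the
      path uses \<open>q\<close>.\<close>
    define c :: "'v \<times> 'v \<Rightarrow> ('v set \<Rightarrow> bool) \<Rightarrow> real" where
      "c q \<omega> = of_bool (bridges k \<omega> x y \<noteq> {} \<and> bridge k \<omega> x y = q)" for q \<omega>
    define c0 :: "('v set \<Rightarrow> bool) \<Rightarrow> real" where "c0 \<omega> = of_bool (bridges k \<omega> x y = {})" for \<omega>
    define h where "h q \<omega> = (Y k \<omega> x (fst q) + Y k \<omega> (snd q) y)\<^sup>2" for q \<omega>
    let ?K = "inner k x \<union> inner k y"
    note sub = cross_subset_inner[OF Suc.prems ns]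
    have fin: "finite (cross k x y)" "cross k x y \<subseteq> I" "finite ?K" "?K \<subseteq> I"
      using finite_subset[OF sub finite_inner] sub inner_subset finite_inner by auto
    have c_dep: "depends_on (c q) (cross k x y)" for q
      unfolding c_def bridge_def by (rule depends_on_comp[OF bridges_depends])
    have c0_dep: "depends_on c0 (cross k x y)"
      unfolding c0_def by (rule depends_on_comp[OF bridges_depends])
    have h_dep: "depends_on (h q) ?K" if "q \<in> ?Q" for q
    proof -
      have "S k x (fst q)" "S k (snd q) y" using that S_sym by auto
      moreover from this have "inner k (snd q) = inner k y" by (intro inner_eq)
      ultimately have "depends_on (\<lambda>\<omega>. Y k \<omega> x (fst q)) ?K" "depends_on (\<lambda>\<omega>. Y k \<omega> (snd q) y) ?K"
        by (auto intro: depends_on_mono[OF Y_depends])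
      then show ?thesis unfolding h_def by (rule depends_on_comp2)
    qed
    have h_int: "integrable M (h q)" if "q \<in> ?Q" for q
      by (rule depends_on_integrable[OF h_dep[OF that] fin(3,4)])
    have c_int: "integrable M (c q)" for q
      by (rule depends_on_integrable[OF c_dep fin(1,2)])
    have c0_int: "integrable M c0"
      by (rule depends_on_integrable[OF c0_dep fin(1,2)])
    have ch: "M.expectation (\<lambda>\<omega>. c q \<omega> * h q \<omega>) = M.expectation (c q) * M.expectation (h q)"
      "integrable M (\<lambda>\<omega>. c q \<omega> * h q \<omega>)" if "q \<in> ?Q" for q
    proof -
      show "M.expectation (\<lambda>\<omega>. c q \<omega> * h q \<omega>) = M.expectation (c q) * M.expectation (h q)"
        by (rule expectation_mult[OF c_dep fin(1,2) h_dep[OF that] fin(3,4) cross_inner_disjoint[OF ns]])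
      show "integrable M (\<lambda>\<omega>. c q \<omega> * h q \<omega>)"
        by (rule depends_on_integrable[OF depends_on_comp2[where J = "cross k x y \<union> ?K"]])
          (use fin in \<open>auto intro: depends_on_mono[OF c_dep] depends_on_mono[OF h_dep[OF that]]\<close>)
    qed
    have sum_c: "(\<Sum>q\<in>?Q. c q \<omega>) \<le> 1" for \<omega>
    proof (cases "bridges k \<omega> x y = {}")
      case False
      then have "(\<Sum>q\<in>?Q. c q \<omega>) = (\<Sum>q\<in>?Q. if bridge k \<omega> x y = q then 1 else 0)"
        by (intro sum.cong) (auto simp: c_def)
      also have "\<dots> \<le> 1" using fQ by (simp only: sum.delta') simp
      finally show ?thesis .
    qed (simp add: c_def)
    \<comment> \<open>At most one term on the right survives: the one of the selected bridge, or the
      detour term.\<close>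
    have pointwise: "(X (Suc k) \<omega> x y)\<^sup>2 \<le>
        (\<Sum>q\<in>?Q. c q \<omega> * h q \<omega>) + c0 \<omega> * (real (L (Suc k)))\<^sup>2" for \<omega>
    proof (cases "bridges k \<omega> x y = {}")
      case True
      have "(X (Suc k) \<omega> x y)\<^sup>2 \<le> (real (L (Suc k)))\<^sup>2"
        using X_Suc_no_bridge[OF ns True Suc.prems] by (intro power_mono) (auto simp: X_def)
      then show ?thesis using True by (simp add: c_def c0_def)
    next
      case False
      obtain u v where uv: "bridge k \<omega> x y = (u, v)" by fastforce
      have q: "(u, v) \<in> ?Q" using bridgeD[OF False uv] by simp
      have "(X (Suc k) \<omega> x y)\<^sup>2 \<le> (Y k \<omega> x u + Y k \<omega> v y)\<^sup>2"
        using X_Suc_bridge[OF ns False uv] by (intro power_mono) (auto simp: X_def)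
      also have "\<dots> = c (u, v) \<omega> * h (u, v) \<omega>" using False uv by (simp add: c_def h_def)
      also have "\<dots> \<le> (\<Sum>q\<in>?Q. c q \<omega> * h q \<omega>)"
        by (rule member_le_sum[OF q _ fQ]) (auto simp: c_def h_def)
      finally show ?thesis using False by (simp add: c0_def)
    qed
    have X_int: "integrable M (\<lambda>\<omega>. (X (Suc k) \<omega> x y)\<^sup>2)"
      by (rule inner_integrable[OF depends_on_comp[OF X_depends[OF Suc.prems]]])
    have "M.expectation (\<lambda>\<omega>. (X (Suc k) \<omega> x y)\<^sup>2) \<le>
        M.expectation (\<lambda>\<omega>. (\<Sum>q\<in>?Q. c q \<omega> * h q \<omega>) + c0 \<omega> * (real (L (Suc k)))\<^sup>2)"
      using c0_int by (intro integral_mono[OF X_int _ pointwise]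
          Bochner_Integration.integrable_add Bochner_Integration.integrable_sum ch(2) integrable_mult_left)
    also have "\<dots> = (\<Sum>q\<in>?Q. M.expectation (\<lambda>\<omega>. c q \<omega> * h q \<omega>))
        + M.expectation c0 * (real (L (Suc k)))\<^sup>2"
      using c0_int ch(2) by (subst Bochner_Integration.integral_add)
        (auto intro!: Bochner_Integration.integrable_sum Bochner_Integration.integral_sum)
    also have "(\<Sum>q\<in>?Q. M.expectation (\<lambda>\<omega>. c q \<omega> * h q \<omega>)) =
        (\<Sum>q\<in>?Q. M.expectation (c q) * M.expectation (h q))"
      by (intro sum.cong refl ch(1))
    also have "\<dots> \<le> (\<Sum>q\<in>?Q. M.expectation (c q) * (5 / 2 * (\<delta> k)\<^sup>2))"
    proof (intro sum_mono mult_left_mono)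
      fix q assume "q \<in> ?Q"
      then show "M.expectation (h q) \<le> 5 / 2 * (\<delta> k)\<^sup>2"
        unfolding h_def by (intro Y_moment[OF ns _ _ Suc.IH]) auto
      show "0 \<le> M.expectation (c q)" by (simp add: c_def)
    qed
    also have "\<dots> = M.expectation (\<lambda>\<omega>. \<Sum>q\<in>?Q. c q \<omega>) * (5 / 2 * (\<delta> k)\<^sup>2)"
      using c_int by (simp only: Bochner_Integration.integral_sum sum_distrib_right)
    also have "\<dots> \<le> 1 * (5 / 2 * (\<delta> k)\<^sup>2)"
    proof (rule mult_right_mono)
      have "M.expectation (\<lambda>\<omega>. \<Sum>q\<in>?Q. c q \<omega>) \<le> M.expectation (\<lambda>\<omega>. 1)"
        by (rule integral_mono[OF _ _ sum_c]) (auto intro: c_int)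
      then show "M.expectation (\<lambda>\<omega>. \<Sum>q\<in>?Q. c q \<omega>) \<le> 1" by (simp add: M.prob_space)
    qed simp
    also have "M.expectation c0 * (real (L (Suc k)))\<^sup>2 \<le> 1"
    proof -
      have "c0 = (\<lambda>\<omega>. of_bool (\<forall>e\<in>cross k x y. \<not> \<omega> e))"
        unfolding c0_def bridges_def cross_def by (intro ext arg_cong[of _ _ of_bool]) blast
      then show ?thesis
        using cross_rare[OF Suc.prems ns] prob_all_closed[OF fin(1,2)] by (simp add: cross_def)
    qed
    \<comment> \<open>The difference between 49/16 and 5/2 is 9/16, and \<open>\<delta> k\<close> is
      at least 2, so the room left is at least 9/4.\<close>
    also have "1 * (5 / 2 * (\<delta> k)\<^sup>2) + 1 \<le> (\<delta> (Suc k))\<^sup>2"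
    proof -
      have "(2 :: real)\<^sup>2 \<le> (\<delta> k)\<^sup>2" using \<delta>_ge[of k] by (intro power_mono) auto
      moreover have "(\<delta> (Suc k))\<^sup>2 = 49 / 16 * (\<delta> k)\<^sup>2" by (simp add: \<delta>_def power2_eq_square)
      ultimately show ?thesis by simp
    qed
    finally show ?thesis by simp
  qed
qed

text \<open>Chebyshev's inequality: exceeding \<open>2 * m k\<close> forces an excess above
  \<open>m k\<close>, which is at least \<open>2 ^ k\<close>, whereas the second moment is at most
  \<open>4 * (49 / 16) ^ k\<close>.\<close>

lemma T_tail:
  assumes "S k x y"
  shows "measure M {\<omega> \<in> space M. real (T k \<omega> x y) > 2 * m k} \<le> 4 * (49 / 64) ^ k"
proof -
  let ?A = "{\<omega> \<in> space M. real (T k \<omega> x y) > 2 * m k}"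
  have mpos: "m k > 0" using m_ge[of k] by (rule less_le_trans[rotated]) simp
  have T_meas: "(\<lambda>\<omega>. real (T k \<omega> x y)) \<in> borel_measurable M"
    by (rule depends_on_measurable[OF depends_on_comp[OF T_depends[OF assms]] finite_inner inner_subset])
  then have A: "?A \<in> sets M" by measurable
  have int: "integrable M (\<lambda>\<omega>. (X k \<omega> x y)\<^sup>2)"
    by (rule inner_integrable[OF depends_on_comp[OF X_depends[OF assms]]])
  have "measure M ?A = M.expectation (indicator ?A)" using A by simp
  also have "\<dots> \<le> M.expectation (\<lambda>\<omega>. (X k \<omega> x y)\<^sup>2 / (m k)\<^sup>2)"
  proof (rule integral_mono)
    show "integrable M (indicat_real ?A)"
      by (intro integrable_real_indicator A) (simp add: M.emeasure_finite less_top[symmetric])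
    show "integrable M (\<lambda>\<omega>. (X k \<omega> x y)\<^sup>2 / (m k)\<^sup>2)" using int by simp
    fix \<omega>
    have "(m k)\<^sup>2 \<le> (X k \<omega> x y)\<^sup>2" if "real (T k \<omega> x y) > 2 * m k"
      using that mpos by (intro power_mono) (auto simp: X_def)
    then show "indicat_real ?A \<omega> \<le> (X k \<omega> x y)\<^sup>2 / (m k)\<^sup>2"
      using mpos by (auto simp: indicator_def)
  qed
  also have "\<dots> = M.expectation (\<lambda>\<omega>. (X k \<omega> x y)\<^sup>2) / (m k)\<^sup>2" by simp
  also have "\<dots> \<le> (\<delta> k)\<^sup>2 / (2 ^ k)\<^sup>2"
    using moment[OF assms] m_ge[of k] by (intro frac_le power_mono) auto
  also have "\<dots> = 4 * (49 / 64) ^ k"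
    by (simp add: \<delta>_def power_mult_distrib power_divide flip: power_mult)
      (simp add: power_mult mult.commute[of k] power_divide[symmetric] flip: power_mult_distrib)
  finally show ?thesis .
qed

text \<open>Formulated for a measurable superset \<open>B\<close> so that it applies directly to
  sections of an event of the joint law.\<close>

lemma graph_dist_tail:
  assumes "S k x y" and B: "B \<in> sets M"
    and sub: "{\<omega> \<in> space M. ereal_of_enat (graph_dist ({e \<in> I. \<omega> e} \<union> E0) x y)
      \<le> ereal (2 * (real (L 0) + 9) * 2 ^ k)} \<subseteq> B"
  shows "measure M B \<ge> 1 - 4 * (49 / 64) ^ k"
proof -
  let ?A = "{\<omega> \<in> space M. real (T k \<omega> x y) > 2 * m k}"
  have [measurable]: "(\<lambda>\<omega>. real (T k \<omega> x y)) \<in> borel_measurable M"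
    by (rule depends_on_measurable[OF depends_on_comp[OF T_depends[OF assms(1)]] finite_inner inner_subset])
  then have A: "?A \<in> sets M" by measurable
  have "space M - ?A \<subseteq> B"
  proof
    fix \<omega> assume \<omega>: "\<omega> \<in> space M - ?A"
    have "(0 :: real) \<le> (7 / 4) ^ k" by simp
    then have "m k \<le> (real (L 0) + 9) * 2 ^ k" unfolding m_def by linarith
    then have "real (T k \<omega> x y) \<le> 2 * (real (L 0) + 9) * 2 ^ k"
      using \<omega> unfolding mult.assoc by auto
    then have "ereal_of_enat (graph_dist ({e \<in> I. \<omega> e} \<union> E0) x y) \<le> ereal (2 * (real (L 0) + 9) * 2 ^ k)"
      by (rule graph_dist_le_walk[OF T_walk[OF assms(1)]])
    then show "\<omega> \<in> B" using \<omega> sub by blast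
  qed
  then have "measure M (space M - ?A) \<le> measure M B" by (rule M.finite_measure_mono[OF _ B])
  then show ?thesis using M.prob_compl[OF A] T_tail[OF assms(1)] by simp
qed

end

section \<open>Cells of the lattice\<close>

text \<open>Cubes of side \<open>r k\<close> in a grid anchored at \<open>z\<close>. The anchor is
  adapted to the pair of points, since a fixed grid can separate neighbours at every level.\<close>

definition same_cell :: "(nat \<Rightarrow> nat) \<Rightarrow> int ^ 'd \<Rightarrow> nat \<Rightarrow> int ^ 'd \<Rightarrow> int ^ 'd \<Rightarrow> bool" where
  "same_cell r z k x y \<longleftrightarrow> (\<forall>i. (x $ i - z $ i) div int (r k) = (y $ i - z $ i) div int (r k))"

lemma card_vec_box:
  fixes A :: "'d::finite \<Rightarrow> 'a set"
  assumes "\<And>i. finite (A i)"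
  shows "finite {y :: 'a ^ 'd. \<forall>i. y $ i \<in> A i}" "card {y :: 'a ^ 'd. \<forall>i. y $ i \<in> A i} = (\<Prod>i\<in>UNIV. card (A i))"
proof -
  have bij: "bij_betw vec_lambda (PiE UNIV A) {y :: 'a ^ 'd. \<forall>i. y $ i \<in> A i}"
    by (rule bij_betwI[where g = vec_nth]) auto
  show "finite {y :: 'a ^ 'd. \<forall>i. y $ i \<in> A i}"
    unfolding bij_betw_finite[OF bij, symmetric] using assms by (intro finite_PiE) auto
  show "card {y :: 'a ^ 'd. \<forall>i. y $ i \<in> A i} = (\<Prod>i\<in>UNIV. card (A i))"
    unfolding bij_betw_same_card[OF bij, symmetric] by (simp add: card_PiE)
qed

lemma div_eq_interval:
  fixes R q s :: int
  assumes "R > 0"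
  shows "{t. q = (t - s) div R} = {s + q * R ..< s + q * R + R}"
proof -
  have "q = (t - s) div R \<longleftrightarrow> q * R \<le> t - s \<and> t - s < q * R + R" for t
  proof
    assume "q = (t - s) div R"
    then show "q * R \<le> t - s \<and> t - s < q * R + R"
      using mult_div_mod_eq[of R "t - s"] pos_mod_sign[OF assms, of "t - s"] pos_mod_bound[OF assms, of "t - s"]
      by (simp only: mult.commute[of R]) linarith
  next
    assume "q * R \<le> t - s \<and> t - s < q * R + R"
    then show "q = (t - s) div R"
      by (intro int_div_pos_eq[symmetric, where r = "t - s - q * R"]) (auto simp: mult.commute)
  qed
  then have "{t. q = (t - s) div R} = {t. q * R \<le> t - s \<and> t - s < q * R + R}" by (simp only:)
  also have "\<dots> = {s + q * R ..< s + q * R + R}" by auto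
  finally show ?thesis .
qed

lemma cell_card:
  fixes z x :: "int ^ 'd::finite"
  assumes "r k > 0"
  shows "finite {y. same_cell r z k x y}" "card {y. same_cell r z k x y} = r k ^ CARD('d)"
proof -
  define A where "A i = {t. (x $ i - z $ i) div int (r k) = (t - z $ i) div int (r k)}" for i
  have A: "finite (A i)" "card (A i) = r k" for i
    unfolding A_def using assms by (simp_all add: div_eq_interval)
  have "{y. same_cell r z k x y} = {y. \<forall>i. y $ i \<in> A i}"
    by (simp add: same_cell_def A_def)
  then show "finite {y. same_cell r z k x y}" "card {y. same_cell r z k x y} = r k ^ CARD('d)"
    using card_vec_box[of A] A by simp_all
qed

lemma same_cell_dist:
  assumes "same_cell r z k x y" "r k > 0"
  shows "\<bar>x $ i - y $ i\<bar> < int (r k)"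
proof -
  let ?q = "(x $ i - z $ i) div int (r k)"
  have "x $ i \<in> {t. ?q = (t - z $ i) div int (r k)}" "y $ i \<in> {t. ?q = (t - z $ i) div int (r k)}"
    using assms(1) by (auto simp: same_cell_def)
  then show ?thesis using assms(2) by (auto simp: div_eq_interval)
qed

text \<open>A unit step towards \<open>y\<close> in a coordinate where the points differ lowers the
  l1-distance by exactly 1.\<close>

lemma nn_walk:
  fixes x y :: "int ^ 'd::finite"
  shows "walk nn_edges (nat (\<Sum>i\<in>UNIV. \<bar>x $ i - y $ i\<bar>)) x y"
proof (induction "nat (\<Sum>i\<in>UNIV. \<bar>x $ i - y $ i\<bar>)" arbitrary: x)
  case 0
  then have "(\<Sum>i\<in>UNIV. \<bar>x $ i - y $ i\<bar>) = 0"
    by (intro antisym sum_nonneg) auto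
  then have "x = y" by (simp add: sum_nonneg_eq_0_iff vec_eq_iff)
  then show ?case by (simp add: walk_refl)
next
  case (Suc n)
  have "x \<noteq> y" using Suc(2) by auto
  then obtain i where i: "x $ i \<noteq> y $ i" by (auto simp: vec_eq_iff)
  define u where "u = (\<chi> j. if j = i then x $ i + sgn (y $ i - x $ i) else x $ j)"
  have "real_point x - real_point u = (- real_of_int (sgn (y $ i - x $ i))) *\<^sub>R axis i 1"
    by (auto simp: vec_eq_iff real_point_def u_def axis_def)
  then have "lattice_dist x u = \<bar>real_of_int (sgn (y $ i - x $ i))\<bar>"
    unfolding lattice_dist_def by (simp add: norm_axis_1)
  also have "\<dots> = 1" using i by (auto simp: sgn_if)
  finally have edge: "{x, u} \<in> nn_edges" unfolding nn_edges_def by blast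
  have "(\<Sum>j\<in>UNIV. \<bar>x $ j - y $ j\<bar>) = \<bar>x $ i - y $ i\<bar> + (\<Sum>j\<in>UNIV - {i}. \<bar>x $ j - y $ j\<bar>)"
    by (rule sum.remove) auto
  moreover have "(\<Sum>j\<in>UNIV. \<bar>u $ j - y $ j\<bar>) = \<bar>u $ i - y $ i\<bar> + (\<Sum>j\<in>UNIV - {i}. \<bar>u $ j - y $ j\<bar>)"
    by (rule sum.remove) auto
  moreover have "(\<Sum>j\<in>UNIV - {i}. \<bar>u $ j - y $ j\<bar>) = (\<Sum>j\<in>UNIV - {i}. \<bar>x $ j - y $ j\<bar>)"
    by (rule sum.cong) (auto simp: u_def)
  moreover have "\<bar>u $ i - y $ i\<bar> = \<bar>x $ i - y $ i\<bar> - 1"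
    using i by (auto simp: u_def sgn_if)
  ultimately have "(\<Sum>j\<in>UNIV. \<bar>u $ j - y $ j\<bar>) = (\<Sum>j\<in>UNIV. \<bar>x $ j - y $ j\<bar>) - 1" by linarith
  then have n: "nat (\<Sum>j\<in>UNIV. \<bar>u $ j - y $ j\<bar>) = n" using Suc(2) by simp
  then have "walk nn_edges n u y" using Suc(1)[of u] by simp
  then show ?case using walk_Cons[OF edge] Suc(2) by metis
qed

lemma lattice_dist_le:
  fixes x y :: "int ^ 'd::finite"
  assumes "\<And>i. \<bar>x $ i - y $ i\<bar> \<le> int R"
  shows "lattice_dist x y \<le> real (CARD('d) * R)"
proof -
  have "lattice_dist x y \<le> (\<Sum>i\<in>UNIV. \<bar>(real_point x - real_point y) $ i\<bar>)"
    unfolding lattice_dist_def by (rule norm_le_l1_cart)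
  also have "\<dots> \<le> (\<Sum>i\<in>(UNIV :: 'd set). real R)"
  proof (rule sum_mono)
    fix i
    have "real_of_int \<bar>x $ i - y $ i\<bar> \<le> real_of_int (int R)" using assms by (simp only: of_int_le_iff)
    then show "\<bar>(real_point x - real_point y) $ i\<bar> \<le> real R" by (simp add: real_point_def)
  qed
  finally show ?thesis by simp
qed

lemma lattice_dist_ge: "real_of_int \<bar>x $ i - y $ i\<bar> \<le> lattice_dist x y"
  using component_le_norm_cart[of "real_point x - real_point y" i]
  by (simp add: lattice_dist_def real_point_def)

lemma lattice_dist_pos: "x \<noteq> y \<Longrightarrow> lattice_dist x y > 0"
  by (auto simp: lattice_dist_def real_point_def vec_eq_iff)

text \<open>Divisibility of the side lengths nests the cells. Two subcells are joined by
  \<open>r k ^ (2 * CARD('d))\<close> potential edges of length at most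
  \<open>D = CARD('d) * r (Suc k)\<close>, each closed with probability at most
  \<open>exp (- lam / D powr \<alpha>)\<close>; \<open>scale\<close> makes the product at most
  \<open>1 / D^2\<close>.\<close>

lemma hierarchy_lattice:
  fixes z :: "int ^ 'd::finite" and p :: "(int ^ 'd) set \<Rightarrow> real"
  assumes p: "\<And>x y. x \<noteq> y \<Longrightarrow> 1 - exp (- (lam / lattice_dist x y powr \<alpha>)) \<le> p {x, y}"
    "\<And>x y. x \<noteq> y \<Longrightarrow> p {x, y} \<le> 1"
    and "lam > 0" "\<alpha> > 0"
    and r: "\<And>k. r k > 0" "\<And>k. r k dvd r (Suc k)"
    and scale: "\<And>k. 2 * ln (real (CARD('d) * r (Suc k))) * real (CARD('d) * r (Suc k)) powr \<alpha>
      \<le> lam * real (r k) ^ (2 * CARD('d))"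
  shows "hierarchy p lattice_edges (same_cell r z) (\<lambda>k. CARD('d) * r k) nn_edges"
proof
  fix e :: "(int ^ 'd) set" assume "e \<in> lattice_edges"
  then obtain x y where e: "e = {x, y}" "x \<noteq> y" by (auto simp: lattice_edges_def)
  have "exp (- (lam / lattice_dist x y powr \<alpha>)) \<le> 1" using \<open>lam > 0\<close> by simp
  then have "0 \<le> p {x, y}" using p(1)[OF e(2)] by linarith
  then show "0 \<le> p e" "p e \<le> 1" using p(2)[OF e(2)] e(1) by auto
next
  fix k and x y :: "int ^ 'd"
  show "same_cell r z k x x" by (simp add: same_cell_def)
  show "same_cell r z k x y \<Longrightarrow> same_cell r z k y x" by (simp add: same_cell_def)
  show "same_cell r z k x y \<Longrightarrow> same_cell r z k y w \<Longrightarrow> same_cell r z k x w" for w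
    by (simp add: same_cell_def)
  show "finite {y. same_cell r z k x y}" by (rule cell_card[of r k, OF r(1)])
  show "same_cell r z k x y \<Longrightarrow> x \<noteq> y \<Longrightarrow> {x, y} \<in> lattice_edges"
    by (auto simp: lattice_edges_def)
  show "1 \<le> CARD('d) * r 0" using r(1)[of 0] by (simp add: Suc_le_eq)
  show Suc_cell: "same_cell r z (Suc k) x y" if "same_cell r z k x y" for x y
  proof -
    obtain q where "r (Suc k) = r k * q" using r(2)[of k] by (auto elim: dvdE)
    then show ?thesis using that by (simp add: same_cell_def zdiv_zmult2_eq)
  qed
  show "\<exists>n\<le>CARD('d) * r k. walk nn_edges n x y" if "same_cell r z k x y"
  proof -
    have "(\<Sum>i\<in>UNIV. \<bar>x $ i - y $ i\<bar>) \<le> (\<Sum>i\<in>(UNIV :: 'd set). int (r k))"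
      using same_cell_dist[of r z k x y, OF that r(1)] by (intro sum_mono) (simp add: less_imp_le)
    then have "nat (\<Sum>i\<in>UNIV. \<bar>x $ i - y $ i\<bar>) \<le> CARD('d) * r k" by (simp add: nat_le_iff)
    then show ?thesis using nn_walk by blast
  qed
  show "(\<Prod>e\<in>{{u, v} |u v. same_cell r z k x u \<and> same_cell r z k y v}. 1 - p e)
      * (real (CARD('d) * r (Suc k)))\<^sup>2 \<le> 1"
    if S: "same_cell r z (Suc k) x y" and nS: "\<not> same_cell r z k x y"
  proof -
    let ?Q = "{u. same_cell r z k x u} \<times> {v. same_cell r z k y v}"
    let ?D = "real (CARD('d) * r (Suc k))"
    let ?q = "lam / ?D powr \<alpha>"
    have D: "?D > 0" using r(1)[of "Suc k"] by simp
    have disj: "\<not> (same_cell r z k x w \<and> same_cell r z k y w)" for w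
      using nS unfolding same_cell_def by metis
    have img: "{{u, v} |u v. same_cell r z k x u \<and> same_cell r z k y v} = (\<lambda>(u, v). {u, v}) ` ?Q"
      by auto
    \<comment> \<open>The two cells are disjoint, so each crossing edge comes from exactly one
      ordered pair and the product over edges becomes a product over pairs.\<close>
    have inj: "inj_on (\<lambda>(u, v). {u, v}) ?Q"
      using disj by (auto simp: inj_on_def doubleton_eq_iff)
    have card: "card ?Q = r k ^ (2 * CARD('d))"
      by (simp add: card_cartesian_product cell_card(2)[of r k, OF r(1)] mult_2 power_add)
    have factor: "0 \<le> 1 - p {u, v} \<and> 1 - p {u, v} \<le> exp (- ?q)" if "(u, v) \<in> ?Q" for u v
    proof -
      have "u \<noteq> v" using that disj by auto
      have "same_cell r z (Suc k) u v"
        using that Suc_cell[of x u] Suc_cell[of y v] S by (simp add: same_cell_def)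
      then have "lattice_dist u v \<le> ?D"
        using same_cell_dist[of r z "Suc k" u v, OF _ r(1)] by (intro lattice_dist_le) (simp add: less_imp_le)
      then have "lattice_dist u v powr \<alpha> \<le> ?D powr \<alpha>"
        using lattice_dist_pos[OF \<open>u \<noteq> v\<close>] \<open>\<alpha> > 0\<close> by (intro powr_mono2) auto
      then have "?q \<le> lam / lattice_dist u v powr \<alpha>"
        using lattice_dist_pos[OF \<open>u \<noteq> v\<close>] \<open>lam > 0\<close> D
        by (intro divide_left_mono mult_pos_pos) (simp_all only: powr_gt_zero less_imp_neq[symmetric] less_imp_le not_False_eq_True)
      then have "exp (- (lam / lattice_dist u v powr \<alpha>)) \<le> exp (- ?q)" by simp
      then show ?thesis using p[OF \<open>u \<noteq> v\<close>] by linarith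
    qed
    have "(\<Prod>e\<in>{{u, v} |u v. same_cell r z k x u \<and> same_cell r z k y v}. 1 - p e)
        = (\<Prod>q\<in>?Q. 1 - p {fst q, snd q})"
      unfolding img by (subst prod.reindex[OF inj]) (simp add: case_prod_beta)
    also have "\<dots> \<le> (\<Prod>q\<in>?Q. exp (- ?q))" using factor by (intro prod_mono) auto
    also have "\<dots> = exp (- ?q) ^ r k ^ (2 * CARD('d))" by (simp only: prod_constant card)
    also have "\<dots> = exp (- (?q * real (r k) ^ (2 * CARD('d))))"
      by (simp add: exp_of_nat_mult[symmetric] mult.commute)
    also have "\<dots> \<le> exp (- (2 * ln ?D))"
    proof -
      have "0 < ?D powr \<alpha>" using D by (simp only: powr_gt_zero less_imp_neq[symmetric] not_False_eq_True)
      then have "2 * ln ?D \<le> lam * real (r k) ^ (2 * CARD('d)) / ?D powr \<alpha>"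
        using scale[of k] by (simp only: pos_le_divide_eq)
      then show ?thesis by (simp only: exp_le_cancel_iff neg_le_iff_le times_divide_eq_left)
    qed
    also have "\<dots> = 1 / ?D\<^sup>2"
    proof -
      have "exp (2 * ln ?D) = exp (ln ?D)  ^ 2" by (simp add: exp_double)
      then show ?thesis using D by (simp only: exp_minus exp_ln) (simp add: divide_inverse)
    qed
    finally show ?thesis using D by (simp only: pos_le_divide_eq zero_less_power)
  qed
qed

section \<open>Choice of the side lengths\<close>

text \<open>
  The exponents are \<open>\<lfloor>A * (\<beta> ^ k + k + \<kappa>)\<rfloor>\<close> with \<open>\<beta> = 2 * n / \<alpha>\<close>: the linear term produces a gain
  \<open>\<beta> * a k - a (k + 1)\<close> of order \<open>A * k\<close>, which pays for the logarithm.
\<close>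

lemma scales_exist:
  fixes \<alpha> lam :: real and n :: nat
  assumes "real n < \<alpha>" "\<alpha> < 2 * real n" "lam > 0"
  obtains a :: "nat \<Rightarrow> nat" where "\<And>k. a k \<le> a (Suc k)" "\<And>k. (2 * real n / \<alpha>) ^ k \<le> real (a k)"
    "\<And>k. 2 * ln (real (n * 2 ^ a (Suc k))) * real (n * 2 ^ a (Suc k)) powr \<alpha>
      \<le> lam * real (2 ^ a k) ^ (2 * n)"
proof -
  define \<beta> where "\<beta> = 2 * real n / \<alpha>"
  have n: "n > 0" using assms by (cases n) auto
  have \<alpha>: "\<alpha> > 0" using assms by simp
  have \<beta>: "\<beta> > 1" using assms \<alpha> by (simp add: \<beta>_def)
  \<comment> \<open>In \<open>\<beta> * b k - b (Suc k)\<close> the shift \<open>\<kappa>\<close>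
    contributes \<open>(\<beta> - 1) * \<kappa>\<close> and the step from \<open>k\<close> to
    \<open>k + 1\<close> costs 1; the value 2 leaves a surplus of 1.\<close>
  define \<kappa> where "\<kappa> = 2 / (\<beta> - 1)"
  have \<kappa>: "\<kappa> > 0" "(\<beta> - 1) * \<kappa> = 2"
    using \<beta> unfolding \<kappa>_def times_divide_eq_right by (simp, intro nonzero_mult_div_cancel_left) simp
  \<comment> \<open>Collects the terms of the logarithmic inequality that depend neither on
    \<open>k\<close> nor on \<open>A\<close>.\<close>
  define K where "K = 2 * ln 2 + ln n + \<alpha> * ln n - ln lam + ln (2 + \<kappa>) + ln (2 * \<beta>)"
  define c where "c = \<alpha> * ln 2"
  have c: "c > 0" using \<alpha> by (simp add: c_def)
  have "\<forall>\<^sub>F A in at_top. K + ln A \<le> c * (A - \<beta>)"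
    using c by real_asymp
  moreover have "\<forall>\<^sub>F A in at_top. ln (2 * \<beta>) / (c * (\<beta> - 1)) \<le> A" by (rule eventually_ge_at_top)
  moreover have "\<forall>\<^sub>F A in at_top. 1 \<le> (A :: real)" "\<forall>\<^sub>F A in at_top. 1 / \<kappa> \<le> (A :: real)"
    by (rule eventually_ge_at_top)+
  ultimately have "\<forall>\<^sub>F A in at_top. K + ln A \<le> c * (A - \<beta>) \<and> ln (2 * \<beta>) / (c * (\<beta> - 1)) \<le> A \<and> 1 \<le> A \<and> 1 / \<kappa> \<le> A"
    by eventually_elim auto
  \<comment> \<open>The first condition settles the part of the inequality that is constant in
    \<open>k\<close>, the second its slope in \<open>k\<close>; the last lets
    \<open>A * \<kappa>\<close> absorb the loss from rounding down.\<close>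
  then obtain A where A: "K + ln A \<le> c * (A - \<beta>)" "ln (2 * \<beta>) / (c * (\<beta> - 1)) \<le> A" "1 \<le> A" "1 / \<kappa> \<le> A"
    using eventually_happens' trivial_limit_at_top_linorder by blast
  have A2: "ln (2 * \<beta>) \<le> c * (\<beta> - 1) * A"
    using A(2) c \<beta> by (simp add: pos_divide_le_eq mult.commute)
  have A4: "1 \<le> A * \<kappa>" using A(4) \<kappa> by (simp add: pos_divide_le_eq)
  define b where "b k = A * (\<beta> ^ k + real k + \<kappa>)" for k
  define a where "a k = nat \<lfloor>b k\<rfloor>" for k
  have \<beta>_pow: "1 \<le> \<beta> ^ k" "\<beta> ^ k \<le> \<beta> ^ Suc k" for k
    using \<beta> by (auto intro: power_increasing one_le_power)
  have b_pos: "b k \<ge> 1" for k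
  proof -
    have "1 * 1 \<le> A * (\<beta> ^ k + real k + \<kappa>)"
      using A(3) \<beta>_pow(1)[of k] \<kappa> by (intro mult_mono) auto
    then show ?thesis by (simp add: b_def)
  qed
  have b_mono: "b k \<le> b (Suc k)" for k
    unfolding b_def using A(3) \<beta>_pow(2)[of k] by (intro mult_left_mono) auto
  have a_bounds: "b k - 1 \<le> real (a k)" "real (a k) \<le> b k" for k
    unfolding a_def using b_pos[of k] by linarith+
  show ?thesis
  proof (rule that)
    show "a k \<le> a (Suc k)" for k
      unfolding a_def by (intro nat_mono floor_mono b_mono)
    show "(2 * real n / \<alpha>) ^ k \<le> real (a k)" for k
    proof -
      have "1 * \<beta> ^ k \<le> A * \<beta> ^ k" using A(3) \<beta> by (intro mult_right_mono) auto
      moreover have "0 \<le> A * real k" using A(3) by simp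
      ultimately have "\<beta> ^ k \<le> b k - 1" using A4 unfolding b_def distrib_left by linarith
      then show ?thesis using a_bounds(1)[of k] by (simp add: \<beta>_def)
    qed
    fix k
    let ?N = "real (n * 2 ^ a (Suc k))"
    have N1: "?N \<ge> 1" unfolding real_of_nat_ge_one_iff using n by simp
    have lnN: "ln ?N = ln n + a (Suc k) * ln 2" using n by (simp add: ln_mult ln_realpow)
    \<comment> \<open>A crude exponential bound suffices: only its logarithm matters, and that is
      linear in \<open>k\<close>.\<close>
    have b'_le: "b (Suc k) \<le> A * ((2 + \<kappa>) * (2 * \<beta>) ^ Suc k)"
    proof -
      have "\<beta> ^ Suc k \<le> (2 * \<beta>) ^ Suc k" using \<beta> by (intro power_mono) auto
      moreover have "real (Suc k) \<le> (2 * \<beta>) ^ Suc k"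
      proof -
        have "real (Suc k) \<le> 2 ^ Suc k" using less_exp[of "Suc k"] by (metis less_imp_le of_nat_le_iff of_nat_numeral of_nat_power)
        also have "\<dots> \<le> (2 * \<beta>) ^ Suc k" using \<beta> by (intro power_mono) auto
        finally show ?thesis .
      qed
      moreover have "\<kappa> * 1 \<le> \<kappa> * (2 * \<beta>) ^ Suc k"
        using \<kappa> \<beta> by (intro mult_left_mono one_le_power) auto
      ultimately have "\<beta> ^ Suc k + real (Suc k) + \<kappa> \<le> (2 + \<kappa>) * (2 * \<beta>) ^ Suc k"
        unfolding distrib_right by linarith
      then show ?thesis unfolding b_def using A(3) by (intro mult_left_mono) auto
    qed
    have "ln (1 + real (a (Suc k))) \<le> ln (2 * (A * ((2 + \<kappa>) * (2 * \<beta>) ^ Suc k)))"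
    proof (rule ln_mono)
      have "1 + real (a (Suc k)) \<le> 2 * b (Suc k)"
        using b_pos[of "Suc k"] a_bounds(2)[of "Suc k"] by linarith
      then show "1 + real (a (Suc k)) \<le> 2 * (A * ((2 + \<kappa>) * (2 * \<beta>) ^ Suc k))"
        using b'_le by linarith
    qed (auto intro: add_pos_nonneg)
    also have "\<dots> = ln 2 + ln A + ln (2 + \<kappa>) + real (Suc k) * ln (2 * \<beta>)"
    proof -
      have "A > 0" "2 + \<kappa> > 0" "(2 * \<beta>) ^ Suc k > 0" using A(3) \<kappa> \<beta> by auto
      then show ?thesis using \<beta> by (simp add: ln_mult_pos ln_realpow distrib_left del: power_Suc)
    qed
    finally have ln_a: "ln (1 + real (a (Suc k))) \<le> ln 2 + ln A + ln (2 + \<kappa>) + real (Suc k) * ln (2 * \<beta>)" .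
    \<comment> \<open>The \<open>- \<beta>\<close> is the price of rounding \<open>b k\<close> down
      to \<open>a k\<close>.\<close>
    have gain: "\<beta> * a k - a (Suc k) \<ge> A * ((\<beta> - 1) * k + 1) - \<beta>"
    proof -
      have "\<beta> * (b k - 1) \<le> \<beta> * a k" using a_bounds(1)[of k] \<beta> by (intro mult_left_mono) auto
      moreover have "\<beta> * b k - b (Suc k) = A * ((\<beta> - 1) * k + ((\<beta> - 1) * \<kappa> - 1))"
        unfolding b_def by (simp add: algebra_simps)
      then have "\<beta> * b k - b (Suc k) = A * ((\<beta> - 1) * k + 1)" by (simp add: \<kappa>(2))
      ultimately show ?thesis using a_bounds(2)[of "Suc k"] by (simp add: right_diff_distrib)
    qed
    \<comment> \<open>With \<open>ln ?N\<close> replaced by the larger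
      \<open>n * (1 + a (Suc k))\<close>, taking logarithms turns the claim into an inequality whose
      two sides are compared through \<open>gain\<close>.\<close>
    have "ln (2 * (n * (1 + real (a (Suc k)))) * ?N powr \<alpha>)
        = ln 2 + ln n + ln (1 + real (a (Suc k))) + \<alpha> * (ln n + a (Suc k) * ln 2)"
    proof -
      have "?N powr \<alpha> > 0" "1 + real (a (Suc k)) > 0" using n N1 by auto
      then have "ln (2 * (n * (1 + real (a (Suc k)))) * ?N powr \<alpha>)
          = ln 2 + (ln n + ln (1 + real (a (Suc k)))) + ln (?N powr \<alpha>)"
        using n by (simp only: ln_mult_pos mult_pos_pos of_nat_0_less_iff zero_less_numeral)
      also have "ln (?N powr \<alpha>) = \<alpha> * (ln n + a (Suc k) * ln 2)"
        unfolding lnN[symmetric] using N1 by (intro ln_powr)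
      finally show ?thesis by simp
    qed
    also have "\<dots> \<le> ln lam + \<alpha> * \<beta> * a k * ln 2"
    proof -
      have "c * (A * ((\<beta> - 1) * k + 1) - \<beta>) \<le> c * (\<beta> * a k - a (Suc k))"
        using gain c by (intro mult_left_mono) auto
      moreover have "real k * ln (2 * \<beta>) \<le> real k * (c * (\<beta> - 1) * A)"
        using A2 by (intro mult_left_mono) auto
      moreover have "c * (A * ((\<beta> - 1) * k + 1) - \<beta>) = real k * (c * (\<beta> - 1) * A) + c * (A - \<beta>)"
        by (simp add: algebra_simps)
      moreover have "real (Suc k) * ln (2 * \<beta>) = real k * ln (2 * \<beta>) + ln (2 * \<beta>)"
        by (simp add: algebra_simps)
      moreover have "c * (\<beta> * a k - a (Suc k)) = \<alpha> * \<beta> * a k * ln 2 - \<alpha> * (a (Suc k) * ln 2)"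
        by (simp add: c_def algebra_simps)
      ultimately show ?thesis using ln_a A(1) unfolding K_def distrib_left by linarith
    qed
    also have "\<dots> = ln (lam * real (2 ^ a k) ^ (2 * n))"
    proof -
      have "\<alpha> * \<beta> = 2 * n" using \<alpha> by (simp add: \<beta>_def)
      then show ?thesis using assms(3) by (simp add: ln_mult_pos ln_realpow)
    qed
    finally have "2 * (n * (1 + real (a (Suc k)))) * ?N powr \<alpha> \<le> lam * real (2 ^ a k) ^ (2 * n)"
      using assms(3) n N1 by (subst (asm) ln_le_cancel_iff) (auto intro!: mult_pos_pos add_pos_nonneg)
    moreover have "2 * ln ?N * ?N powr \<alpha> \<le> 2 * (n * (1 + real (a (Suc k)))) * ?N powr \<alpha>"
    proof (intro mult_right_mono mult_left_mono)
      have "ln (real n) \<le> n" using n ln_le_minus_one[of "real n"] by simp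
      moreover have "real (a (Suc k)) * ln 2 \<le> real (a (Suc k)) * 1"
        using ln2_le_25_over_36 by (intro mult_left_mono) auto
      moreover have "1 * real (a (Suc k)) \<le> n * real (a (Suc k))" using n by (intro mult_right_mono) auto
      ultimately show "ln ?N \<le> n * (1 + real (a (Suc k)))" unfolding lnN distrib_left by linarith
    qed auto
    ultimately show "2 * ln ?N * ?N powr \<alpha> \<le> lam * real (2 ^ a k) ^ (2 * n)" by linarith
  qed
qed

section \<open>Scale-free percolation with nearest-neighbour edges\<close>

text \<open>Weights of at least 1 only raise the edge probabilities above those for constant weight
  1, so the bound is uniform in \<open>W\<close>.\<close>

lemma edges_law_graph_dist:
  fixes W :: "int ^ 'd::finite \<Rightarrow> real" and x y :: "int ^ 'd"
  assumes W: "\<And>x. W x \<ge> 1" and "lam > 0" "\<alpha> > 0"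
    and r: "\<And>k. r k > 0" "\<And>k. r k dvd r (Suc k)"
    and scale: "\<And>k. 2 * ln (real (CARD('d) * r (Suc k))) * real (CARD('d) * r (Suc k)) powr \<alpha>
      \<le> lam * real (r k) ^ (2 * CARD('d))"
    and close: "\<And>i. \<bar>x $ i - y $ i\<bar> < int (r k)"
    and B: "B \<in> sets (edges_law \<alpha> lam W)"
    and sub: "{\<eta> \<in> space (edges_law \<alpha> lam W).
      ereal_of_enat (graph_dist ({e \<in> lattice_edges. \<eta> e} \<union> nn_edges) x y)
        \<le> ereal (2 * (real (CARD('d) * r 0) + 9) * 2 ^ k)} \<subseteq> B"
  shows "measure (edges_law \<alpha> lam W) B \<ge> 1 - 4 * (49 / 64) ^ k"
proof -
  \<comment> \<open>With the coordinatewise minimum as anchor, both points have quotient 0 in every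
    coordinate at level \<open>k\<close>.\<close>
  define z :: "int ^ 'd" where "z = (\<chi> i. min (x $ i) (y $ i))"
  have "(x $ i - z $ i) div int (r k) = 0 \<and> (y $ i - z $ i) div int (r k) = 0" for i
    using close[of i] by (auto simp: z_def min_def intro!: div_pos_pos_trivial)
  then have cell: "same_cell r z k x y" by (simp add: same_cell_def)
  interpret hierarchy "edge_prob \<alpha> lam W" lattice_edges "same_cell r z" "\<lambda>k. CARD('d) * r k" nn_edges
  proof (rule hierarchy_lattice[where r = r, OF _ _ \<open>lam > 0\<close> \<open>\<alpha> > 0\<close> r scale])
    fix u v :: "int ^ 'd" assume "u \<noteq> v"
    have "1 * 1 \<le> W u * W v" by (rule mult_mono) (use W[of u] W[of v] in auto)
    then have "lam * (1 / lattice_dist u v powr \<alpha>) \<le> lam * (W u * W v / lattice_dist u v powr \<alpha>)"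
      using \<open>lam > 0\<close> by (intro mult_left_mono divide_right_mono) auto
    then show "1 - exp (- (lam / lattice_dist u v powr \<alpha>)) \<le> edge_prob \<alpha> lam W {u, v}"
      by (simp add: edge_prob_doubleton[OF \<open>u \<noteq> v\<close>] connection_prob_def)
    show "edge_prob \<alpha> lam W {u, v} \<le> 1"
      by (simp add: edge_prob_doubleton[OF \<open>u \<noteq> v\<close>] connection_prob_def)
  qed
  have M: "M = edges_law \<alpha> lam W" by (simp add: M_def edges_law_def)
  show ?thesis
    using graph_dist_tail[OF cell, of B] B sub unfolding M by blast
qed

lemma AE_weights_ge_1:
  assumes "\<tau> > 1"
  shows "AE W in weights_law \<tau>. \<forall>x :: int ^ 'd::finite. W x \<ge> 1"
  unfolding AE_all_countable
proof
  fix x :: "int ^ 'd"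
  interpret prob_space "weight_law \<tau>" by (rule prob_space_weight_law[OF assms])
  have "AE w in weight_law \<tau>. w \<in> {1..}"
    by (rule AE_prob_1) (simp add: weight_law_tail[OF assms])
  then have "AE w in weight_law \<tau>. w \<ge> 1" by simp
  then show "AE W in weights_law \<tau>. W x \<ge> 1"
    unfolding weights_law_def by (intro AE_PiM_component[OF prob_space_weight_law[OF assms]]) auto
qed

text \<open>A bound uniform over weights of at least 1 survives integration over the weights, as
  these satisfy the constraint almost surely.\<close>

lemma measure_sfp_ge:
  fixes B :: "((int ^ 'd::finite \<Rightarrow> real) \<times> ((int ^ 'd) set \<Rightarrow> bool)) set"
  assumes "\<tau> > 1" and B: "B \<in> sets (weights_law \<tau> \<Otimes>\<^sub>M edge_config_space)"
    and le: "\<And>W. (\<And>x. W x \<ge> 1) \<Longrightarrow> c \<le> measure (edges_law \<alpha> lam W) (Pair W -` B)"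
  shows "c \<le> measure (sfp \<tau> \<alpha> lam) B"
proof -
  interpret W: prob_space "weights_law \<tau>" by (rule prob_space_weights_law[OF assms(1)])
  interpret S: prob_space "sfp \<tau> \<alpha> lam" by (rule prob_space_sfp[OF assms(1)])
  have "ennreal c = (\<integral>\<^sup>+W. ennreal c \<partial>(weights_law \<tau> :: (int ^ 'd \<Rightarrow> real) measure))"
    by (simp add: W.emeasure_space_1)
  also have "\<dots> \<le> (\<integral>\<^sup>+W. emeasure (edges_law \<alpha> lam W) (Pair W -` B) \<partial>weights_law \<tau>)"
  proof (rule nn_integral_mono_AE)
    show "AE W in weights_law \<tau>. ennreal c \<le> emeasure (edges_law \<alpha> lam W) (Pair W -` B)"
      using AE_weights_ge_1[OF assms(1)]
    proof eventually_elim
      case (elim W)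
      interpret prob_space "edges_law \<alpha> lam W" by (rule prob_space_edges_law)
      show ?case unfolding emeasure_eq_measure using elim by (intro ennreal_leI le) auto
    qed
  qed
  also have "\<dots> = emeasure (sfp \<tau> \<alpha> lam) B" by (rule emeasure_sfp[OF assms(1) B, symmetric])
  finally show ?thesis
    unfolding S.emeasure_eq_measure by (simp add: measure_nonneg)
qed

theorem mainTheorem2:
  fixes \<tau> \<alpha> lam \<gamma> \<Delta> d :: real
  defines "d \<equiv> real CARD('d::finite)"
  defines "\<gamma> \<equiv> \<alpha> * (\<tau> - 1) / d"
  defines "\<Delta> \<equiv> ln 2 / ln (2 * d / \<alpha>)"
  assumes "\<tau> > 1" and "\<alpha> > 0" and "lam > 0"
    and "ereal lam > critical_lambda TYPE('d) \<tau> \<alpha>"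
    and "\<gamma> > 2" and "d < \<alpha>" and "\<alpha> < 2 * d"
    and "\<tau> \<ge> 3 \<or> (\<tau> < 3 \<and> \<alpha> * (\<tau> - 2) \<ge> d)"
  shows "\<exists>C>0. ((\<lambda>(x :: int ^ 'd, y).
      measure (sfp \<tau> \<alpha> lam)
        {\<omega> \<in> space (sfp \<tau> \<alpha> lam).
           ereal_of_enat (graph_dist (open_edges \<omega> \<union> nn_edges) x y)
             \<le> ereal (C * ln (lattice_dist x y) powr \<Delta>)})
      \<longlongrightarrow> 1) (filtercomap (\<lambda>(x, y). lattice_dist x y) at_top)"
proof -
  obtain a :: "nat \<Rightarrow> nat" where a: "\<And>k. a k \<le> a (Suc k)" "\<And>k. (2 * d / \<alpha>) ^ k \<le> real (a k)"
    "\<And>k. 2 * ln (real (CARD('d) * 2 ^ a (Suc k))) * real (CARD('d) * 2 ^ a (Suc k)) powr \<alpha>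
      \<le> lam * real (2 ^ a k) ^ (2 * CARD('d))"
    using scales_exist[of "CARD('d)" \<alpha> lam] assms by blast
  define \<beta> where "\<beta> = 2 * d / \<alpha>"
  have \<beta>: "\<beta> > 1" using assms(5,10) by (simp add: \<beta>_def)
  define r :: "nat \<Rightarrow> nat" where "r k = 2 ^ a k" for k
  have r: "r k > 0" "r k dvd r (Suc k)" for k
    using a(1)[of k] by (simp_all add: r_def le_imp_power_dvd)
  have r_mono: "r j \<le> r k" if "j \<le> k" for j k
    using that by (rule lift_Suc_mono_le[rotated]) (simp add: r_def a(1))
  \<comment> \<open>\<open>K * 2 ^ k\<close> is the distance bound at level \<open>k\<close>. In
    \<open>C\<close>, the factor 2 pays for using level \<open>k + 1\<close> at distances from
    \<open>r k\<close> on, and the power of \<open>ln 2\<close> for side lengths being powers of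
    2.\<close>
  define K where "K = 2 * (real (CARD('d) * r 0) + 9)"
  define C where "C = 2 * K / ln 2 powr \<Delta>"
  have K: "K > 0" by (simp add: K_def add_nonneg_pos)
  have C: "C > 0" using K by (simp add: C_def)
  have \<Delta>: "\<Delta> > 0" unfolding \<Delta>_def \<beta>_def[symmetric] using \<beta> by simp
  \<comment> \<open>The origin of the exponent: raising the side length to the power \<beta> doubles
    the distance bound.\<close>
  have \<beta>_\<Delta>: "(\<beta> ^ k) powr \<Delta> = 2 ^ k" for k
  proof -
    have "\<beta> powr \<Delta> = exp (\<Delta> * ln \<beta>)" using \<beta> by (simp add: powr_def)
    also have "\<Delta> * ln \<beta> = ln 2" unfolding \<Delta>_def \<beta>_def[symmetric] using \<beta> by simp
    finally have "\<beta> powr \<Delta> = 2" by simp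
    then show ?thesis using \<beta> by (simp add: powr_realpow[symmetric] powr_powr mult.commute)
        (simp add: powr_powr[symmetric] powr_realpow)
  qed
  define B where "B x y = {\<omega> \<in> space (sfp \<tau> \<alpha> lam).
           ereal_of_enat (graph_dist (open_edges \<omega> \<union> nn_edges) x y)
             \<le> ereal (C * ln (lattice_dist x y) powr \<Delta>)}" for x y :: "int ^ 'd"
  interpret S: prob_space "sfp \<tau> \<alpha> lam :: ((int ^ 'd \<Rightarrow> real) \<times> _) measure"
    by (rule prob_space_sfp[OF assms(4)])
  have sp: "space (sfp \<tau> \<alpha> lam) = space (weights_law \<tau> \<Otimes>\<^sub>M edge_config_space :: ((int ^ 'd \<Rightarrow> real) \<times> _) measure)"
    by (rule sets_eq_imp_space_eq[OF sets_sfp[OF assms(4)]])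
  have B_sets: "B x y \<in> sets (weights_law \<tau> \<Otimes>\<^sub>M edge_config_space)" for x y :: "int ^ 'd"
    unfolding B_def sp using measurable_graph_dist_le by (simp only: pred_def)
  \<comment> \<open>Such a pair fits into one cell of level \<open>k + 1\<close>, while the
    logarithm of its distance is at least \<open>\<beta> ^ k * ln 2\<close>.\<close>
  have bound: "1 - 4 * (49 / 64) ^ Suc k \<le> measure (sfp \<tau> \<alpha> lam) (B x y)"
    if lo: "real (r k) \<le> lattice_dist x y" and hi: "lattice_dist x y < real (r (Suc k))"
    for x y :: "int ^ 'd" and k
  proof (rule measure_sfp_ge[OF assms(4) B_sets])
    fix W :: "int ^ 'd \<Rightarrow> real" assume W: "\<And>x. W x \<ge> 1"
    have "K * 2 ^ Suc k = C * (2 ^ k * ln 2 powr \<Delta>)" by (simp add: C_def)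
    also have "2 ^ k * ln 2 powr \<Delta> = (\<beta> ^ k * ln 2) powr \<Delta>"
      using \<beta> by (simp add: powr_mult \<beta>_\<Delta>)
    also have "C * (\<beta> ^ k * ln 2) powr \<Delta> \<le> C * ln (lattice_dist x y) powr \<Delta>"
    proof (intro mult_left_mono powr_mono2)
      have "\<beta> ^ k * ln 2 \<le> real (a k) * ln 2" using a(2)[of k] by (simp add: \<beta>_def)
      also have "\<dots> = ln (real (r k))" by (simp add: r_def ln_realpow)
      also have "\<dots> \<le> ln (lattice_dist x y)" using lo r(1)[of k] by (intro ln_mono) auto
      finally show "\<beta> ^ k * ln 2 \<le> ln (lattice_dist x y)" .
    qed (use C \<Delta> \<beta> in auto)
    finally have KC: "K * 2 ^ Suc k \<le> C * ln (lattice_dist x y) powr \<Delta>" .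
    show "1 - 4 * (49 / 64) ^ Suc k \<le> measure (edges_law \<alpha> lam W) (Pair W -` B x y)"
    proof (rule edges_law_graph_dist[where r = r, OF W assms(6,5) r])
      show "2 * ln (real (CARD('d) * r (Suc k))) * real (CARD('d) * r (Suc k)) powr \<alpha>
        \<le> lam * real (r k) ^ (2 * CARD('d))" for k
        unfolding r_def by (rule a(3))
      show "\<bar>x $ i - y $ i\<bar> < int (r (Suc k))" for i
        using lattice_dist_ge[of x i y] hi by linarith
      show "Pair W -` B x y \<in> sets (edges_law \<alpha> lam W)"
        unfolding sets_edges_law by (rule sets_Pair1[OF B_sets])
      show "{\<eta> \<in> space (edges_law \<alpha> lam W).
          ereal_of_enat (graph_dist ({e \<in> lattice_edges. \<eta> e} \<union> nn_edges) x y)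
            \<le> ereal (2 * (real (CARD('d) * r 0) + 9) * 2 ^ Suc k)} \<subseteq> Pair W -` B x y"
      proof (intro subsetI vimageI2)
        fix \<eta> assume \<eta>: "\<eta> \<in> {\<eta> \<in> space (edges_law \<alpha> lam W).
          ereal_of_enat (graph_dist ({e \<in> lattice_edges. \<eta> e} \<union> nn_edges) x y)
            \<le> ereal (2 * (real (CARD('d) * r 0) + 9) * 2 ^ Suc k)}"
        then have "(W, \<eta>) \<in> space (sfp \<tau> \<alpha> lam)"
          unfolding sp using sets_eq_imp_space_eq[OF sets_edges_law[of \<alpha> lam W]]
          by (simp add: space_pair_measure space_weights_law)
        moreover have "ereal_of_enat (graph_dist ({e \<in> lattice_edges. \<eta> e} \<union> nn_edges) x y)
            \<le> ereal (C * ln (lattice_dist x y) powr \<Delta>)"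
          using \<eta> KC unfolding K_def[symmetric] by (auto elim!: order_trans)
        ultimately show "(W, \<eta>) \<in> B x y" by (simp add: B_def open_edges_def)
      qed
    qed
  qed
  have "((\<lambda>(x, y). measure (sfp \<tau> \<alpha> lam) (B x y)) \<longlongrightarrow> 1)
      (filtercomap (\<lambda>(x :: int ^ 'd, y). lattice_dist x y) at_top)"
  proof (rule tendstoI)
    fix \<epsilon> :: real assume "\<epsilon> > 0"
    have "(\<lambda>k. 4 * (49 / 64 :: real) ^ k) \<longlonglongrightarrow> 4 * 0"
      by (intro tendsto_mult tendsto_const LIMSEQ_realpow_zero) auto
    then have "\<forall>\<^sub>F k in sequentially. 4 * (49 / 64 :: real) ^ k < \<epsilon>"
      using \<open>\<epsilon> > 0\<close> by (intro order_tendstoD(2)) auto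
    then obtain j where j: "\<And>k. k \<ge> j \<Longrightarrow> 4 * (49 / 64 :: real) ^ k < \<epsilon>"
      by (auto simp: eventually_sequentially)
    have near: "dist (measure (sfp \<tau> \<alpha> lam) (B x y)) 1 < \<epsilon>" if far: "real (r j) \<le> lattice_dist x y"
      for x y :: "int ^ 'd"
    proof -
      \<comment> \<open>The side lengths are unbounded because \<open>a k\<close> dominates
        \<open>\<beta> ^ k\<close>.\<close>
      obtain k where "lattice_dist x y < \<beta> ^ k" using real_arch_pow[OF \<beta>] by blast
      also have "\<beta> ^ k \<le> real (a k)" using a(2) by (simp add: \<beta>_def)
      also have "\<dots> < real (r k)" by (simp add: r_def)
      finally have ex: "lattice_dist x y < real (r k)" .
      \<comment> \<open>The least level whose side length exceeds the distance. It lies above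
        \<open>j\<close>, so it has a predecessor and \<open>bound\<close> applies.\<close>
      define l where "l = (LEAST k. lattice_dist x y < real (r k))"
      have l: "lattice_dist x y < real (r l)" unfolding l_def by (rule LeastI[where P = "\<lambda>k. lattice_dist x y < real (r k)", OF ex])
      have "j < l"
      proof (rule ccontr)
        assume "\<not> j < l"
        then have "real (r l) \<le> real (r j)" by (simp add: r_mono)
        then show False using l far by simp
      qed
      then obtain k' where k': "l = Suc k'" "j \<le> k'" by (cases l) auto
      have "real (r k') \<le> lattice_dist x y"
        using not_less_Least[of k' "\<lambda>k. lattice_dist x y < real (r k)"] k'(1) by (simp add: l_def)
      then have "1 - 4 * (49 / 64) ^ l \<le> measure (sfp \<tau> \<alpha> lam) (B x y)"
        using bound l unfolding k'(1) by blast
      moreover have "measure (sfp \<tau> \<alpha> lam) (B x y) \<le> 1" by (rule S.prob_le_1)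
      ultimately show ?thesis using j[of l] \<open>j < l\<close> by (simp add: dist_real_def)
    qed
    show "\<forall>\<^sub>F q in filtercomap (\<lambda>(x :: int ^ 'd, y). lattice_dist x y) at_top.
        dist (case q of (x, y) \<Rightarrow> measure (sfp \<tau> \<alpha> lam) (B x y)) 1 < \<epsilon>"
      unfolding eventually_filtercomap
      by (rule exI[of _ "\<lambda>N. real (r j) \<le> N"]) (auto simp: eventually_ge_at_top near)
  qed
  then show ?thesis using C unfolding B_def by blast
qed

end
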